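(* There exists a sequence of finite groups $(G_i)$ such that $$\sup_i \max_{\chi\in\mathrm{Irr}(G_i)} d_\chi = +\infty \quad\text{and yet}\quad \sup_i \mathrm{AM}_{\mathrm Z}(G_i) = 5.$$
   Context: All characters are complex characters. For a finite group $G$: $\mathrm{Irr}(G)$ is the set of irreducible characters of $G$, $d_\chi$ is the degree of $\chi$ (the dimension of the corresponding irreducible representation), $\mathrm{Conj}(G)$ is the set of conjugacy classes of $G$, and $\chi(C)$ is the common value of $\chi$ on the elements of a conjugacy class $C$. The ZL-amenability constant of a finite group $G$ (the amenability constant of the centre of $\ell^1(G)$) is $$\mathrm{AM}_{\mathrm Z}(G) = \frac{1}{|G|^2}\sum_{C,D\in \mathrm{Conj}(G)} \left| \sum_{\chi\in \mathrm{Irr}(G)} d_\chi^2\, \chi(C)\overline{\chi(D)} \right| \, |C|\,|D|.$$ *)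

theory Defs
  imports
    "HOL-Library.Extended_Real"
    "HOL-Algebra.Group_Action"
    "Jordan_Normal_Form.VS_Connect"
begin

definition GL :: "nat \<Rightarrow> complex mat monoid" where
  "GL n = units_of (ring_mat TYPE(complex) n ())"

definition invariant_subspace ::
    "('a, 'b) monoid_scheme \<Rightarrow> nat \<Rightarrow> ('a \<Rightarrow> complex mat) \<Rightarrow> complex vec set \<Rightarrow> bool" where
  "invariant_subspace G n \<rho> W \<longleftrightarrow>
     VectorSpace.subspace class_ring W (module_vec TYPE(complex) n) \<and>
     (\<forall>g \<in> carrier G. \<forall>w \<in> W. \<rho> g *\<^sub>v w \<in> W)"

definition irreducible_rep :: "('a, 'b) monoid_scheme \<Rightarrow> nat \<Rightarrow> ('a \<Rightarrow> complex mat) \<Rightarrow> bool" where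
  "irreducible_rep G n \<rho> \<longleftrightarrow>
     \<rho> \<in> hom G (GL n) \<and> n > 0 \<and>
     (\<forall>W. invariant_subspace G n \<rho> W \<longrightarrow> W = {0\<^sub>v n} \<or> W = carrier_vec n)"

definition mat_trace :: "complex mat \<Rightarrow> complex" where
  "mat_trace A = (\<Sum>i < dim_row A. A $$ (i, i))"

text \<open>Characters are made extensional (\<open>undefined\<close> outside the carrier), so that characters that
  agree on the group are equal and \<open>Irr G\<close> is a finite set for finite \<open>G\<close>.\<close>

definition rep_character :: "('a, 'b) monoid_scheme \<Rightarrow> ('a \<Rightarrow> complex mat) \<Rightarrow> 'a \<Rightarrow> complex" where
  "rep_character G \<rho> = (\<lambda>g \<in> carrier G. mat_trace (\<rho> g))"

definition Irr :: "('a, 'b) monoid_scheme \<Rightarrow> ('a \<Rightarrow> complex) set" where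
  "Irr G = {\<chi>. \<exists>n \<rho>. irreducible_rep G n \<rho> \<and> \<chi> = rep_character G \<rho>}"

definition char_degree :: "('a, 'b) monoid_scheme \<Rightarrow> ('a \<Rightarrow> complex) \<Rightarrow> nat" where
  "char_degree G \<chi> = (THE n. \<exists>\<rho>. irreducible_rep G n \<rho> \<and> \<chi> = rep_character G \<rho>)"

definition Conj :: "('a, 'b) monoid_scheme \<Rightarrow> 'a set set" where
  "Conj G = orbits G (carrier G) (\<lambda>g. \<lambda>h \<in> carrier G. g \<otimes>\<^bsub>G\<^esub> h \<otimes>\<^bsub>G\<^esub> inv\<^bsub>G\<^esub> g)"

definition class_value :: "('a \<Rightarrow> complex) \<Rightarrow> 'a set \<Rightarrow> complex" where
  "class_value \<chi> C = the_elem (\<chi> ` C)"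

definition AM_Z :: "('a, 'b) monoid_scheme \<Rightarrow> real" where
  "AM_Z G = 1 / (real (Coset.order G))\<^sup>2 *
     (\<Sum>C \<in> Conj G. \<Sum>D \<in> Conj G.
        cmod (\<Sum>\<chi> \<in> Irr G. (of_nat (char_degree G \<chi>))\<^sup>2 * class_value \<chi> C * cnj (class_value \<chi> D))
          * real (card C) * real (card D))"

text \<open>The degree and the value on a conjugacy class are well defined.\<close>

lemma hom_GL_carrier:
  assumes "\<rho> \<in> hom G (GL n)" "g \<in> carrier G"
  shows "\<rho> g \<in> carrier_mat n n"
  using assms by (auto simp: hom_def GL_def units_of_def Units_def ring_mat_simps)

lemma GL_group: "group (GL n)"
proof -
  interpret ring "ring_mat TYPE(complex) n ()" by (rule ring_mat)
  show ?thesis unfolding GL_def by (rule units_group)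
qed

lemma hom_GL_one:
  assumes "group G" "\<rho> \<in> hom G (GL n)"
  shows "\<rho> \<one>\<^bsub>G\<^esub> = 1\<^sub>m n"
  using hom_one[OF assms(2,1) GL_group] by (simp add: GL_def units_of_def ring_mat_simps)

lemma rep_character_one:
  assumes "group G" "\<rho> \<in> hom G (GL n)"
  shows "rep_character G \<rho> \<one>\<^bsub>G\<^esub> = of_nat n"
  using hom_GL_one[OF assms] group.is_monoid[OF assms(1)]
  by (simp add: rep_character_def mat_trace_def monoid.one_closed)

lemma char_degree_eq:
  assumes "group G" "irreducible_rep G n \<rho>"
  shows "char_degree G (rep_character G \<rho>) = n"
  unfolding char_degree_def
proof (rule the_equality)
  fix m assume "\<exists>\<sigma>. irreducible_rep G m \<sigma> \<and> rep_character G \<rho> = rep_character G \<sigma>"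
  then obtain \<sigma> where s: "irreducible_rep G m \<sigma>" "rep_character G \<rho> = rep_character G \<sigma>" by blast
  have "(of_nat m :: complex) = of_nat n"
    using rep_character_one[OF assms(1)] s assms(2) unfolding irreducible_rep_def by metis
  then show "m = n" by simp
qed (use assms in blast)

lemma mat_trace_comm:
  assumes "A \<in> carrier_mat n n" "B \<in> carrier_mat n n"
  shows "mat_trace (A * B) = mat_trace (B * A)"
proof -
  have "mat_trace (A * B) = (\<Sum>i<n. \<Sum>j<n. A $$ (i, j) * B $$ (j, i))"
    using assms by (auto simp: mat_trace_def scalar_prod_def atLeast0LessThan intro!: sum.cong)
  also have "\<dots> = (\<Sum>j<n. \<Sum>i<n. B $$ (j, i) * A $$ (i, j))"
    by (subst sum.swap) (simp add: mult.commute)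
  also have "\<dots> = mat_trace (B * A)"
    using assms by (auto simp: mat_trace_def scalar_prod_def atLeast0LessThan intro!: sum.cong)
  finally show ?thesis .
qed

lemma rep_character_conj:
  assumes "group G" "\<rho> \<in> hom G (GL n)" "g \<in> carrier G" "h \<in> carrier G"
  shows "rep_character G \<rho> (g \<otimes>\<^bsub>G\<^esub> h \<otimes>\<^bsub>G\<^esub> inv\<^bsub>G\<^esub> g) = rep_character G \<rho> h"
proof -
  interpret group G by fact
  have m: "\<rho> (x \<otimes>\<^bsub>G\<^esub> y) = \<rho> x * \<rho> y" if "x \<in> carrier G" "y \<in> carrier G" for x y
    using assms(2) that by (auto simp: hom_def GL_def units_of_def ring_mat_simps)
  have "mat_trace (\<rho> (g \<otimes>\<^bsub>G\<^esub> h \<otimes>\<^bsub>G\<^esub> inv\<^bsub>G\<^esub> g)) = mat_trace (\<rho> (g \<otimes>\<^bsub>G\<^esub> h) * \<rho> (inv\<^bsub>G\<^esub> g))"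
    using assms by (simp add: m)
  also have "\<dots> = mat_trace (\<rho> (inv\<^bsub>G\<^esub> g) * \<rho> (g \<otimes>\<^bsub>G\<^esub> h))"
    by (rule mat_trace_comm) (use assms hom_GL_carrier[OF assms(2)] in auto)
  also have "\<dots> = mat_trace (\<rho> (inv\<^bsub>G\<^esub> g \<otimes>\<^bsub>G\<^esub> (g \<otimes>\<^bsub>G\<^esub> h)))"
    using assms by (simp add: m)
  also have "inv\<^bsub>G\<^esub> g \<otimes>\<^bsub>G\<^esub> (g \<otimes>\<^bsub>G\<^esub> h) = h"
    using assms by (simp add: m_assoc[symmetric])
  finally show ?thesis using assms by (simp add: rep_character_def)
qed

lemma class_value_eq:
  assumes "group G" "\<chi> \<in> Irr G" "C \<in> Conj G" "g \<in> C"
  shows "class_value \<chi> C = \<chi> g"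
proof -
  obtain n \<rho> where r: "\<rho> \<in> hom G (GL n)" "\<chi> = rep_character G \<rho>"
    using assms(2) by (auto simp: Irr_def irreducible_rep_def)
  obtain h where h: "h \<in> carrier G" "C = {x \<otimes>\<^bsub>G\<^esub> h \<otimes>\<^bsub>G\<^esub> inv\<^bsub>G\<^esub> x | x. x \<in> carrier G}"
    using assms(3) by (auto simp: Conj_def orbits_def orbit_def)
  have "\<chi> x = \<chi> h" if "x \<in> C" for x
    using that h r rep_character_conj[OF assms(1) r(1)] by auto
  then have "\<chi> ` C = {\<chi> g}" using assms(4) by fastforce
  then show ?thesis by (simp add: class_value_def)
qed

end

theory Submission
  imports
    Defs
    "Jordan_Normal_Form.Char_Poly"
    "HOL-Number_Theory.Number_Theory"
    "HOL-Computational_Algebra.Fundamental_Theorem_Algebra"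
    "HOL-Library.Nat_Bijection"
begin

text \<open>
  The groups are the affine groups of the prime fields. Split an irreducible representation
  according to its subspace of vectors fixed by the translations, which is invariant because the
  translations form a normal subgroup. If everything is fixed, the representation factors through the
  cyclic quotient and is linear. If nothing is fixed, then the character sums to zero over every coset
  of the translations; as it is constant on the nontrivial translations and on each nontrivial coset,
  it is determined by its degree. The degree is \<open>p - 1\<close>: the orbit of an eigenvector of a translation
  spans, and all nontrivial \<open>p\<close>-th roots of unity occur as eigenvalues.

  With these \<open>p - 1\<close> linear characters and one character of degree \<open>p - 1\<close>, the constant is
  \<open>5 - 8 / p\<close>.
\<close>

section \<open>The constant as a sum over group elements\<close>

text \<open>Characters are constant on classes and the classes partition the group, so the weights
  \<open>card C * card D\<close> just count pairs of elements. The later computation can then ignore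
  class sizes.\<close>

lemma AM_Z_sum_elements:
  assumes "group G" "finite (carrier G)"
  shows "AM_Z G = 1 / (real (Coset.order G))\<^sup>2 * (\<Sum>x\<in>carrier G. \<Sum>y\<in>carrier G.
    cmod (\<Sum>\<chi>\<in>Irr G. (of_nat (char_degree G \<chi>))\<^sup>2 * \<chi> x * cnj (\<chi> y)))"
proof -
  interpret group_action G "carrier G" "\<lambda>g. \<lambda>h \<in> carrier G. g \<otimes>\<^bsub>G\<^esub> h \<otimes>\<^bsub>G\<^esub> inv\<^bsub>G\<^esub> g"
    by (rule group.action_by_conjugation[OF assms(1)])
  let ?d = "\<lambda>\<chi>. of_nat (char_degree G \<chi>) :: complex"
  let ?K = "\<lambda>C D. cmod (\<Sum>\<chi>\<in>Irr G. (?d \<chi>)\<^sup>2 * class_value \<chi> C * cnj (class_value \<chi> D))"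
  let ?k = "\<lambda>x y. cmod (\<Sum>\<chi>\<in>Irr G. (?d \<chi>)\<^sup>2 * \<chi> x * cnj (\<chi> y))"
  have "(\<Sum>C\<in>Conj G. \<Sum>D\<in>Conj G. ?K C D * real (card C) * real (card D))
      = (\<Sum>C\<in>Conj G. \<Sum>D\<in>Conj G. \<Sum>x\<in>C. \<Sum>y\<in>D. ?k x y)"
  proof (intro sum.cong refl)
    fix C D assume C: "C \<in> Conj G" and D: "D \<in> Conj G"
    have "?k x y = ?K C D" if "x \<in> C" "y \<in> D" for x y
      using class_value_eq[OF assms(1) _ C that(1)] class_value_eq[OF assms(1) _ D that(2)]
      by (intro arg_cong[of _ _ cmod] sum.cong) auto
    then have "(\<Sum>x\<in>C. \<Sum>y\<in>D. ?k x y) = (\<Sum>x\<in>C. \<Sum>y\<in>D. ?K C D)"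
      by (intro sum.cong) auto
    then show "?K C D * real (card C) * real (card D) = (\<Sum>x\<in>C. \<Sum>y\<in>D. ?k x y)"
      by (simp add: mult_ac)
  qed
  also have "\<dots> = (\<Sum>C\<in>Conj G. \<Sum>x\<in>C. \<Sum>D\<in>Conj G. \<Sum>y\<in>D. ?k x y)"
    by (intro sum.cong refl) (rule sum.swap)
  also have "\<dots> = (\<Sum>x\<in>carrier G. \<Sum>y\<in>carrier G. ?k x y)"
    unfolding Conj_def by (simp add: disjoint_sum[OF assms(2)])
  finally show ?thesis by (simp add: AM_Z_def)
qed

section \<open>Linear algebra\<close>

lemma subspace_module_vec_iff:
  "VectorSpace.subspace class_ring W (module_vec TYPE(complex) n) \<longleftrightarrow>
     W \<subseteq> carrier_vec n \<and> 0\<^sub>v n \<in> W \<and> (\<forall>v\<in>W. \<forall>w\<in>W. v + w \<in> W) \<and> (\<forall>c. \<forall>v\<in>W. c \<cdot>\<^sub>v v \<in> W)"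
  by (auto simp: VectorSpace.subspace_def submodule_def vec_vs vec_module module_vec_simps)

text \<open>Vectors of all dimensions share one type, so there is no single zero vector; finite sums
  are therefore formed coordinatewise, here and below.\<close>

lemma sum_vec_closed:
  assumes "W \<subseteq> carrier_vec n" "(0\<^sub>v n :: 'a::comm_monoid_add vec) \<in> W"
    and add: "\<And>v w. v \<in> W \<Longrightarrow> w \<in> W \<Longrightarrow> v + w \<in> W" and "finite S" "\<And>i. i \<in> S \<Longrightarrow> f i \<in> W"
  shows "vec n (\<lambda>j. \<Sum>i\<in>S. f i $ j) \<in> W"
  using assms(4,5)
proof (induction S rule: finite_induct)
  case empty
  have "vec n (\<lambda>j. \<Sum>i\<in>{}. f i $ j) = 0\<^sub>v n" by auto
  then show ?case using assms(2) by simp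
next
  case (insert a S)
  have "f a + vec n (\<lambda>j. \<Sum>i\<in>S. f i $ j) \<in> W"
    using insert by (intro add) auto
  also have "f a + vec n (\<lambda>j. \<Sum>i\<in>S. f i $ j) = vec n (\<lambda>j. \<Sum>i\<in>insert a S. f i $ j)"
    using insert assms(1) by (intro eq_vecI) auto
  finally show ?case .
qed

lemma mult_mat_vec_sum:
  fixes A :: "'a::comm_semiring_0 mat"
  assumes A: "A \<in> carrier_mat m n" and f: "\<And>i. i \<in> S \<Longrightarrow> f i \<in> carrier_vec n"
  shows "A *\<^sub>v vec n (\<lambda>j. \<Sum>i\<in>S. f i $ j) = vec m (\<lambda>j. \<Sum>i\<in>S. (A *\<^sub>v f i) $ j)"
proof (intro eq_vecI)
  fix j assume "j < dim_vec (vec m (\<lambda>j. \<Sum>i\<in>S. (A *\<^sub>v f i) $ j))"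
  then have j: "j < m" by simp
  have "(A *\<^sub>v vec n (\<lambda>j. \<Sum>i\<in>S. f i $ j)) $ j = (\<Sum>l<n. \<Sum>i\<in>S. A $$ (j, l) * f i $ l)"
    using A j by (auto simp: scalar_prod_def atLeast0LessThan sum_distrib_left intro!: sum.cong)
  also have "\<dots> = (\<Sum>i\<in>S. \<Sum>l<n. A $$ (j, l) * f i $ l)" by (rule sum.swap)
  also have "\<dots> = (\<Sum>i\<in>S. (A *\<^sub>v f i) $ j)"
  proof (intro sum.cong refl)
    fix i assume "i \<in> S"
    then have "f i \<in> carrier_vec n" using f by simp
    then show "(\<Sum>l<n. A $$ (j, l) * f i $ l) = (A *\<^sub>v f i) $ j"
      using A j by (auto simp: scalar_prod_def atLeast0LessThan intro!: sum.cong)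
  qed
  finally show "(A *\<^sub>v vec n (\<lambda>j. \<Sum>i\<in>S. f i $ j)) $ j =
      vec m (\<lambda>j. \<Sum>i\<in>S. (A *\<^sub>v f i) $ j) $ j" using j by simp
qed (use A in simp)

text \<open>Adding \<open>c\<close> permutes the residues modulo \<open>p\<close>. This makes a sum
  over all translations invariant under translation.\<close>

lemma sum_shift_mod:
  fixes F :: "nat \<Rightarrow> 'a::comm_monoid_add"
  assumes "p > 0"
  shows "(\<Sum>b<p. F ((c + b) mod p)) = (\<Sum>b<p. F b)"
proof (rule sum.reindex_bij_betw)
  have "inj_on (\<lambda>b. (c + b) mod p) {..<p}"
    by (auto simp: inj_on_def cong_add_lcancel_nat simp flip: cong_def dest: cong_less_modulus_unique_nat)
  then show "bij_betw (\<lambda>b. (c + b) mod p) {..<p} {..<p}"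
    using assms by (intro bij_betw_imageI endo_inj_surj) auto
qed

text \<open>If \<open>m < n\<close>, the vectors padded by zero columns form a singular square
  matrix. A nonzero kernel vector of its transpose is orthogonal to every \<open>f i\<close>, hence
  to all unit vectors, which is absurd.\<close>

lemma generating_family_card:
  fixes f :: "nat \<Rightarrow> 'a::field vec"
  assumes span: "\<And>v. v \<in> carrier_vec n \<Longrightarrow> \<exists>c. v = vec n (\<lambda>j. \<Sum>i<m. c i * f i $ j)"
  shows "n \<le> m"
proof (rule ccontr)
  assume "\<not> n \<le> m"
  then have mn: "m < n" by simp
  define B where "B = mat n n (\<lambda>(i, j). if j < m then f j $ i else 0)"
  have B: "B \<in> carrier_mat n n" by (simp add: B_def)
  have "B *\<^sub>v unit_vec n m = 0\<^sub>v n"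
    using mn by (intro eq_vecI) (auto simp: B_def)
  then have "det B = 0"
    using det_0_iff_vec_prod_zero_field[OF B] mn by (metis unit_vec_carrier unit_vec_nonzero)
  then have "det (transpose_mat B) = 0" by (simp add: det_transpose[OF B])
  then obtain y where y: "y \<in> carrier_vec n" "y \<noteq> 0\<^sub>v n" "transpose_mat B *\<^sub>v y = 0\<^sub>v n"
    using det_0_iff_vec_prod_zero_field[of "transpose_mat B" n] B by auto
  have orth: "(\<Sum>j<n. f i $ j * y $ j) = 0" if "i < m" for i
  proof -
    have "(transpose_mat B *\<^sub>v y) $ i = (\<Sum>j<n. f i $ j * y $ j)"
      using that mn y(1) by (auto simp: B_def scalar_prod_def atLeast0LessThan intro!: sum.cong)
    then show ?thesis using y(3) that mn by simp
  qed
  have "y $ k = 0" if k: "k < n" for k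
  proof -
    obtain c where c: "unit_vec n k = vec n (\<lambda>j. \<Sum>i<m. c i * f i $ j)"
      using span[of "unit_vec n k"] by auto
    have "y $ k = (\<Sum>j<n. unit_vec n k $ j * y $ j)"
      using k by (simp add: unit_vec_def if_distrib[of "\<lambda>x. x * _"] cong: if_cong)
    also have "\<dots> = (\<Sum>j<n. \<Sum>i<m. c i * (f i $ j * y $ j))"
      by (simp add: c sum_distrib_right sum_distrib_left mult_ac)
    also have "\<dots> = (\<Sum>i<m. c i * (\<Sum>j<n. f i $ j * y $ j))"
      by (subst sum.swap) (simp add: sum_distrib_left)
    also have "\<dots> = 0" using orth by simp
    finally show ?thesis .
  qed
  then show False using y(1,2) by auto
qed

lemma complex_mat_has_eigenvector:
  fixes A :: "complex mat"
  assumes A: "A \<in> carrier_mat n n" and n: "n > 0"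
  obtains v z where "v \<in> carrier_vec n" "v \<noteq> 0\<^sub>v n" "A *\<^sub>v v = z \<cdot>\<^sub>v v"
proof -
  have "\<not> constant (poly (char_poly A))"
    using degree_monic_char_poly[OF A] n by (simp add: constant_degree)
  then obtain z where "poly (char_poly A) z = 0"
    using fundamental_theorem_of_algebra by blast
  then have "eigenvalue A z" using eigenvalue_root_char_poly[OF A] by simp
  then show ?thesis using that A unfolding eigenvalue_def eigenvector_def by auto
qed

lemma card_eigenvalues_le:
  fixes A :: "'a::field mat"
  assumes A: "A \<in> carrier_mat n n" and ev: "\<And>z. z \<in> S \<Longrightarrow> eigenvalue A z"
  shows "card S \<le> n"
proof -
  have nz: "char_poly A \<noteq> 0" using degree_monic_char_poly[OF A] by auto
  have "S \<subseteq> {z. poly (char_poly A) z = 0}" using ev eigenvalue_root_char_poly[OF A] by auto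
  then have "card S \<le> card {z. poly (char_poly A) z = 0}"
    by (intro card_mono poly_roots_finite nz)
  also have "\<dots> \<le> n" using card_poly_roots_bound[OF nz] degree_monic_char_poly[OF A] by simp
  finally show ?thesis .
qed

section \<open>Matrix representations\<close>

lemma hom_GL_mult:
  assumes "\<rho> \<in> hom G (GL n)" "x \<in> carrier G" "y \<in> carrier G"
  shows "\<rho> (x \<otimes>\<^bsub>G\<^esub> y) = \<rho> x * \<rho> y"
  using assms by (auto simp: hom_def GL_def units_of_def ring_mat_simps)

lemma hom_GL_mult_vec:
  assumes "\<rho> \<in> hom G (GL n)" "x \<in> carrier G" "y \<in> carrier G" "v \<in> carrier_vec n"
  shows "\<rho> (x \<otimes>\<^bsub>G\<^esub> y) *\<^sub>v v = \<rho> x *\<^sub>v (\<rho> y *\<^sub>v v)"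
  unfolding hom_GL_mult[OF assms(1-3)]
  by (rule assoc_mult_mat_vec[OF hom_GL_carrier hom_GL_carrier]) (use assms in auto)

lemma hom_GL_I:
  assumes "group G" and carr: "\<And>x. x \<in> carrier G \<Longrightarrow> \<rho> x \<in> carrier_mat n n"
    and one: "\<rho> \<one>\<^bsub>G\<^esub> = 1\<^sub>m n"
    and mult: "\<And>x y. x \<in> carrier G \<Longrightarrow> y \<in> carrier G \<Longrightarrow> \<rho> (x \<otimes>\<^bsub>G\<^esub> y) = \<rho> x * \<rho> y"
  shows "\<rho> \<in> hom G (GL n)"
proof -
  interpret group G by fact
  have "\<rho> x \<in> Units (ring_mat TYPE(complex) n ())" if x: "x \<in> carrier G" for x
    unfolding Units_def ring_mat_simps
    using carr[OF x] carr[of "inv\<^bsub>G\<^esub> x"] mult[of x "inv\<^bsub>G\<^esub> x"] mult[of "inv\<^bsub>G\<^esub> x" x] one x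
    by (auto intro!: bexI[of _ "\<rho> (inv\<^bsub>G\<^esub> x)"])
  then show ?thesis
    using mult by (auto simp: hom_def GL_def units_of_def ring_mat_simps)
qed

lemma mat_trace_mult:
  assumes "A \<in> carrier_mat n n" "B \<in> carrier_mat n n"
  shows "mat_trace (A * B) = (\<Sum>i<n. \<Sum>j<n. A $$ (i, j) * B $$ (j, i))"
  using assms by (auto simp: mat_trace_def scalar_prod_def atLeast0LessThan intro!: sum.cong)

text \<open>Conjugation invariance in a form free of inverses: two elements are recognised as
  conjugate by writing them as the two products of one pair.\<close>

lemma rep_character_mult_comm:
  assumes "group G" "\<rho> \<in> hom G (GL n)" "x \<in> carrier G" "y \<in> carrier G"
  shows "rep_character G \<rho> (x \<otimes>\<^bsub>G\<^esub> y) = rep_character G \<rho> (y \<otimes>\<^bsub>G\<^esub> x)"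
proof -
  interpret group G by fact
  show ?thesis
    using assms(3,4) mat_trace_comm[of "\<rho> x" n "\<rho> y"] hom_GL_carrier[OF assms(2)]
    by (simp add: rep_character_def hom_GL_mult[OF assms(2)])
qed

text \<open>The linear combinations of the \<open>f i\<close> form an invariant subspace, nonzero
  because of \<open>f s\<close>, so by irreducibility they are everything. This gives both upper
  bounds on dimensions, \<open>1\<close> and \<open>p - 1\<close>.\<close>

lemma irreducible_rep_dim_le:
  assumes irr: "irreducible_rep G n \<rho>"
    and f: "\<And>i. i < m \<Longrightarrow> f i \<in> carrier_vec n"
    and nz: "s < m" "f s \<noteq> 0\<^sub>v n"
    and perm: "\<And>x i. x \<in> carrier G \<Longrightarrow> i < m \<Longrightarrow> \<exists>j<m. \<exists>a. \<rho> x *\<^sub>v f i = a \<cdot>\<^sub>v f j"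
  shows "n \<le> m"
proof -
  define W where "W = {vec n (\<lambda>j. \<Sum>i<m. c i * f i $ j) | c. True}"
  have \<rho>: "\<rho> \<in> hom G (GL n)" using irr by (simp add: irreducible_rep_def)
  have W_sub: "W \<subseteq> carrier_vec n" by (auto simp: W_def)
  have W_0: "0\<^sub>v n \<in> W"
    unfolding W_def by (auto intro!: exI[of _ "\<lambda>_. 0"])
  have W_add: "v + w \<in> W" if vw: "v \<in> W" "w \<in> W" for v w
  proof -
    obtain c d where "v = vec n (\<lambda>j. \<Sum>i<m. c i * f i $ j)" "w = vec n (\<lambda>j. \<Sum>i<m. d i * f i $ j)"
      using vw by (auto simp: W_def)
    then have "v + w = vec n (\<lambda>j. \<Sum>i<m. (c i + d i) * f i $ j)"
      by (auto simp: sum.distrib algebra_simps)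
    then show ?thesis by (auto simp: W_def)
  qed
  have W_smult: "a \<cdot>\<^sub>v v \<in> W" if v: "v \<in> W" for a v
  proof -
    obtain c where "v = vec n (\<lambda>j. \<Sum>i<m. c i * f i $ j)"
      using v by (auto simp: W_def)
    then have "a \<cdot>\<^sub>v v = vec n (\<lambda>j. \<Sum>i<m. (a * c i) * f i $ j)"
      by (auto simp: sum_distrib_left algebra_simps)
    then show ?thesis unfolding W_def by (auto intro!: exI[of _ "\<lambda>i. a * c i"])
  qed
  have W_f: "f i \<in> W" if i: "i < m" for i
  proof -
    have "f i = vec n (\<lambda>j. \<Sum>l<m. (if l = i then 1 else 0) * f l $ j)"
      using f[OF i] i by (intro eq_vecI) (auto simp: if_distrib[of "\<lambda>x. x * _"] cong: if_cong)
    then show ?thesis unfolding W_def by (intro CollectI exI conjI TrueI)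
  qed
  have W_inv: "\<rho> x *\<^sub>v v \<in> W" if x: "x \<in> carrier G" and v: "v \<in> W" for x v
  proof -
    obtain c where c: "v = vec n (\<lambda>j. \<Sum>i<m. c i * f i $ j)"
      using v by (auto simp: W_def)
    have A: "\<rho> x \<in> carrier_mat n n" by (rule hom_GL_carrier[OF \<rho> x])
    have "c i \<cdot>\<^sub>v (\<rho> x *\<^sub>v f i) \<in> W" if "i < m" for i
      using perm[OF x that] W_f W_smult by force
    then have "vec n (\<lambda>j. \<Sum>i<m. (c i \<cdot>\<^sub>v (\<rho> x *\<^sub>v f i)) $ j) \<in> W"
      by (intro sum_vec_closed W_sub W_0 W_add) auto
    also have "vec n (\<lambda>j. \<Sum>i<m. (c i \<cdot>\<^sub>v (\<rho> x *\<^sub>v f i)) $ j) =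
        vec n (\<lambda>j. \<Sum>i<m. (\<rho> x *\<^sub>v (c i \<cdot>\<^sub>v f i)) $ j)"
      using mult_mat_vec[OF A f] by (intro eq_vecI) (auto intro!: sum.cong)
    also have "\<dots> = \<rho> x *\<^sub>v vec n (\<lambda>j. \<Sum>i<m. (c i \<cdot>\<^sub>v f i) $ j)"
      using f by (intro mult_mat_vec_sum[OF A, symmetric]) auto
    also have "vec n (\<lambda>j. \<Sum>i<m. (c i \<cdot>\<^sub>v f i) $ j) = v"
      using f unfolding c by (intro eq_vecI) (auto simp: carrier_vecD[OF f] intro!: sum.cong)
    finally show ?thesis .
  qed
  have "invariant_subspace G n \<rho> W"
    using W_sub W_0 W_add W_smult W_inv by (auto simp: invariant_subspace_def subspace_module_vec_iff)
  moreover have "W \<noteq> {0\<^sub>v n}" using W_f nz by blast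
  ultimately have "W = carrier_vec n" using irr by (auto simp: irreducible_rep_def)
  then show ?thesis
    by (intro generating_family_card[where f = f]) (auto simp: W_def)
qed

section \<open>Roots of unity\<close>

text \<open>The order of \<open>z\<close> divides the prime \<open>p\<close> and is not
  \<open>1\<close>, so it equals \<open>p\<close>.\<close>

lemma prime_order_power_eq_iff:
  fixes z :: "'a::field"
  assumes p: "prime p" and z: "z ^ p = 1" "z \<noteq> 1"
  shows "z ^ a = z ^ b \<longleftrightarrow> [a = b] (mod p)"
proof -
  have z0: "z \<noteq> 0" using z p by (auto simp: zero_power prime_gt_0_nat)
  have one: "z ^ c = 1 \<longleftrightarrow> p dvd c" for c
  proof
    assume "p dvd c" then show "z ^ c = 1" using z by (auto simp: power_mult)
  next
    assume c: "z ^ c = 1"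
    show "p dvd c"
    proof (rule ccontr)
      assume "\<not> p dvd c"
      then have cop: "coprime c p" using prime_imp_coprime[OF p, of c] by (simp add: coprime_commute)
      \<comment> \<open>Bezout writes \<open>1\<close> as \<open>c * x - p * y\<close>; since
        \<open>z ^ c\<close> and \<open>z ^ p\<close> are both \<open>1\<close>, this forces
        \<open>z = 1\<close>.\<close>
      then have "c \<noteq> 0" using p by (metis coprime_0_left_iff not_prime_unit)
      then obtain x y where "c * x = p * y + gcd c p" using bezout_nat by blast
      then have "z ^ (c * x) = z ^ (p * y + 1)" using cop by simp
      then show False using z c by (simp add: power_mult power_add)
    qed
  qed
  have le: "z ^ a = z ^ b \<longleftrightarrow> [a = b] (mod p)" if "a \<le> b" for a b
  proof -
    have "z ^ b = z ^ a * z ^ (b - a)" using that by (simp add: power_add[symmetric])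
    then have "z ^ a = z ^ b \<longleftrightarrow> z ^ (b - a) = 1" using z0 by auto
    also have "\<dots> \<longleftrightarrow> [a = b] (mod p)"
      using that one[of "b - a"] by (metis cong_altdef_nat cong_sym_eq)
    finally show ?thesis .
  qed
  show ?thesis using le[of a b] le[of b a] by (metis cong_sym_eq nat_le_linear)
qed

lemma sum_powers_root_of_unity:
  fixes z :: "'a::field"
  assumes "z ^ p = 1"
  shows "(\<Sum>b<p. z ^ b) = (if z = 1 then of_nat p else 0)"
  using assms by (auto simp: sum_gp_strict)

text \<open>Multiplication by the primitive root \<open>w\<close> permutes the \<open>m\<close>-th
  roots of unity and multiplies the sum by \<open>w ^ k * cnj (w ^ l)\<close>, which is not
  \<open>1\<close> unless \<open>k = l\<close>. It is the column orthogonality of the linear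
  characters.\<close>

lemma roots_of_unity_orthogonal:
  assumes "k < m" "l < m"
  shows "(\<Sum>a | a ^ m = 1. a ^ k * cnj (a ^ l)) = (if k = l then of_nat m else (0 :: complex))"
proof -
  have m: "m > 0" using assms by simp
  have unit: "a * cnj a = 1" if "a ^ m = 1" for a :: complex
    using power_eq_1_iff[OF that] m by (simp add: complex_norm_square[symmetric])
  define w where "w = cis (2 * pi / real m)"
  have wm: "w ^ m = 1" using m by (simp add: w_def DeMoivre)
  have inj: "w ^ k = w ^ l \<longleftrightarrow> k = l"
    using bij_betw_imp_inj_on[OF bij_betw_roots_unity[OF m]] assms
    by (auto simp: w_def DeMoivre inj_on_def mult_ac)
  have w0: "w \<noteq> 0" using wm m by (auto simp: zero_power)
  have w1: "w * cnj w = 1" by (rule unit[OF wm])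
  let ?S = "\<Sum>a | a ^ m = 1. a ^ k * cnj (a ^ l)"
  have "bij_betw ((*) w) {a. a ^ m = 1} {a. a ^ m = 1}"
    using wm w0 by (intro bij_betwI[of _ _ _ "\<lambda>a. a / w"]) (auto simp: power_mult_distrib power_divide)
  from sum.reindex_bij_betw[OF this, of "\<lambda>a. a ^ k * cnj (a ^ l)"]
  have "?S = w ^ k * cnj (w ^ l) * ?S"
    by (simp add: power_mult_distrib sum_distrib_left mult_ac)
  \<comment> \<open>Multiplying by \<open>w ^ l\<close> removes the conjugate, because
    \<open>w * cnj w = 1\<close>.\<close>
  then have "?S * w ^ l = w ^ k * ?S * (w * cnj w) ^ l"
    by (simp add: power_mult_distrib mult_ac)
  then have eq: "(w ^ l - w ^ k) * ?S = 0" using w1 by (simp add: algebra_simps)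
  show ?thesis
  proof (cases "k = l")
    case True
    have "?S = (\<Sum>a | a ^ m = (1::complex). 1)"
    proof (intro sum.cong refl)
      fix a :: complex assume "a \<in> {a. a ^ m = 1}"
      then have "(a * cnj a) ^ k = 1" using unit by simp
      then show "a ^ k * cnj (a ^ l) = 1" using True by (simp add: power_mult_distrib)
    qed
    then show ?thesis using True card_roots_unity_eq[OF m] by simp
  next
    case False then show ?thesis using eq inj by auto
  qed
qed

section \<open>The affine group of a prime field\<close>

text \<open>The pair \<open>(b, k)\<close> encodes the affine map \<open>x \<mapsto> g ^ k * x + b\<close> of the field with \<open>p\<close> elements, where
  \<open>g\<close> is a primitive root.\<close>

locale affine_group =
  fixes p g :: nat
  assumes p: "prime p" and p_gt_2: "p > 2" and g: "residue_primroot p g"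
begin

text \<open>Arguments are reduced on entry, so any natural numbers may be used and equality of
  elements becomes a pair of congruences. The pairing makes the elements natural numbers, so that
  all groups of the sequence have one type.\<close>

definition elt :: "nat \<Rightarrow> nat \<Rightarrow> nat" where
  "elt b k = prod_encode (b mod p, k mod (p - 1))"

text \<open>The product is composition of affine maps, the right factor being applied first.\<close>

definition G :: "nat monoid" where
  "G = \<lparr>carrier = range (\<lambda>(b, k). elt b k),
        monoid.mult = (\<lambda>x y. case prod_decode x of (b, k) \<Rightarrow> case prod_decode y of (c, l) \<Rightarrow>
                  elt (b + g ^ k * c) (k + l)),
        one = elt 0 0\<rparr>"

text \<open>Keeps the simplifier from turning the \<open>1\<close> in \<open>p - 1\<close> and
  \<open>elt 1 0\<close> into \<open>Suc 0\<close>.\<close>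

declare One_nat_def [simp del]

lemma pos: "p > 0" "p - 1 > 0" "p > 1"
  using p_gt_2 by auto

text \<open>Modulo \<open>p\<close>, the natural number \<open>(p - 1) * x\<close> plays the role of
  minus \<open>x\<close>, which avoids subtraction below.\<close>

lemma pred_mult_add: "(p - 1) * x + x = p * x"
  using pos by (cases p) auto

lemma elt_eq_iff: "elt b k = elt c l \<longleftrightarrow> [b = c] (mod p) \<and> [k = l] (mod (p - 1))"
  by (simp add: elt_def cong_def)

lemma elt_eqI: "[b = c] (mod p) \<Longrightarrow> [k = l] (mod (p - 1)) \<Longrightarrow> elt b k = elt c l"
  by (simp add: elt_eq_iff)

text \<open>A primitive root has order \<open>totient p = p - 1\<close>.\<close>

lemma gpow_cong_iff: "[g ^ k = g ^ l] (mod p) \<longleftrightarrow> [k = l] (mod (p - 1))"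
  using g p by (simp add: residue_primroot_def order_divides_expdiff totient_prime)

lemma ex_gpow_cong:
  assumes "\<not> p dvd b"
  obtains k where "[g ^ k = b] (mod p)"
proof -
  have "b mod p \<in> totatives p"
    using assms prime_imp_coprime[OF p, of b] pos
    by (auto simp: totatives_def coprime_commute mod_greater_zero_iff_not_dvd less_imp_le)
  also have "totatives p = (\<lambda>i. g ^ i mod p) ` {..<totient p}"
    using residue_primroot_is_generator[OF pos(3) g] by (simp add: bij_betw_def)
  finally show ?thesis using that by (auto simp: cong_def)
qed

lemma ex_neg_exp: obtains l where "[k + l = 0] (mod (p - 1))"
proof
  have "p - 1 = Suc (p - 2)" using p_gt_2 by simp
  then have "k + (p - 2) * k = (p - 1) * k" by simp
  then show "[k + (p - 2) * k = 0] (mod (p - 1))" by (simp add: cong_0_iff)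
qed

lemma ex_gpow_div: obtains c where "[g ^ k * c = b] (mod p)"
proof -
  obtain l where "[k + l = 0] (mod (p - 1))" by (rule ex_neg_exp)
  then have "[g ^ (k + l) = g ^ 0] (mod p)" by (simp only: gpow_cong_iff)
  then have "[g ^ (k + l) * b = g ^ 0 * b] (mod p)" by (rule cong_scalar_right)
  then show ?thesis using that[of "g ^ l * b"] by (simp add: power_add mult_ac)
qed

lemma elt_in [simp]: "elt b k \<in> carrier G"
  by (auto simp: G_def)

lemma carrier_cases:
  assumes "x \<in> carrier G"
  obtains b k where "x = elt b k" "b < p" "k < p - 1"
proof -
  obtain b k where "x = elt b k" using assms by (auto simp: G_def)
  then have "x = elt (b mod p) (k mod (p - 1))" by (simp add: elt_def)
  then show ?thesis using that pos by simp
qed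

text \<open>Reducing \<open>k\<close> modulo \<open>p - 1\<close> does not change
  \<open>g ^ k\<close> modulo \<open>p\<close>, so products can be computed with unreduced
  arguments.\<close>

lemma mult_elt [simp]: "elt b k \<otimes>\<^bsub>G\<^esub> elt c l = elt (b + g ^ k * c) (k + l)"
proof -
  have "[g ^ (k mod (p - 1)) = g ^ k] (mod p)" by (simp add: gpow_cong_iff)
  then have "[b mod p + g ^ (k mod (p - 1)) * (c mod p) = b + g ^ k * c] (mod p)"
    by (intro cong_add cong_mult) (auto simp: cong_def)
  moreover have "[k mod (p - 1) + l mod (p - 1) = k + l] (mod (p - 1))"
    by (simp add: cong_def mod_add_eq)
  ultimately have "elt (b mod p + g ^ (k mod (p - 1)) * (c mod p)) (k mod (p - 1) + l mod (p - 1)) =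
      elt (b + g ^ k * c) (k + l)" by (rule elt_eqI)
  then show ?thesis by (simp add: G_def elt_def)
qed

lemma one_G [simp]: "\<one>\<^bsub>G\<^esub> = elt 0 0"
  by (simp add: G_def)

lemma group_G: "group G"
proof (rule groupI)
  fix x assume "x \<in> carrier G"
  then obtain b k where x: "x = elt b k" by (rule carrier_cases)
  obtain l where l: "[k + l = 0] (mod (p - 1))" by (rule ex_neg_exp)
  \<comment> \<open>The inverse of \<open>x \<mapsto> g ^ k * x + b\<close> has the opposite
    exponent \<open>l\<close> and translation part minus \<open>g ^ l * b\<close>.\<close>
  have "elt ((p - 1) * (g ^ l * b)) l \<otimes>\<^bsub>G\<^esub> x = elt (p * (g ^ l * b)) (k + l)"
    using pos by (simp add: x algebra_simps diff_mult_distrib2)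
  also have "\<dots> = \<one>\<^bsub>G\<^esub>" using l by (auto intro!: elt_eqI simp: cong_0_iff)
  finally show "\<exists>y\<in>carrier G. y \<otimes>\<^bsub>G\<^esub> x = \<one>\<^bsub>G\<^esub>" by (metis elt_in)
qed (auto elim!: carrier_cases simp: algebra_simps power_add)

lemma bij_elt: "bij_betw (\<lambda>(b, k). elt b k) ({..<p} \<times> {..<p - 1}) (carrier G)"
  unfolding bij_betw_def
proof
  show "inj_on (\<lambda>(b, k). elt b k) ({..<p} \<times> {..<p - 1})"
    by (auto simp: inj_on_def elt_eq_iff cong_less_modulus_unique_nat)
  show "(\<lambda>(b, k). elt b k) ` ({..<p} \<times> {..<p - 1}) = carrier G"
    by (auto elim!: carrier_cases)
qed

lemma finite_G: "finite (carrier G)"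
  using bij_betw_finite[OF bij_elt] by simp

lemma order_G: "Coset.order G = p * (p - 1)"
  using bij_betw_same_card[OF bij_elt] by (simp add: Coset.order_def)

lemma sum_G: "(\<Sum>x\<in>carrier G. F x) = (\<Sum>k<p - 1. \<Sum>b<p. F (elt b k))"
proof -
  have "(\<Sum>x\<in>carrier G. F x) = (\<Sum>b<p. \<Sum>k<p - 1. F (elt b k))"
    using sum.reindex_bij_betw[OF bij_elt, of F]
    by (simp add: sum.cartesian_product case_prod_unfold)
  also have "\<dots> = (\<Sum>k<p - 1. \<Sum>b<p. F (elt b k))" by (rule sum.swap)
  finally show ?thesis .
qed

section \<open>The candidates for the irreducible characters, and the linear ones among them\<close>

definition lin_char :: "complex \<Rightarrow> nat \<Rightarrow> complex" where
  "lin_char a = (\<lambda>x\<in>carrier G. a ^ snd (prod_decode x))"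

text \<open>The permutation character on the field with \<open>p\<close> elements minus the trivial
  character: the number of fixed points of the affine map, less one.\<close>

definition big_char :: "nat \<Rightarrow> complex" where
  "big_char = (\<lambda>x\<in>carrier G. case prod_decode x of (b, k) \<Rightarrow>
     if k \<noteq> 0 then 0 else if b = 0 then of_nat (p - 1) else -1)"

lemma lin_char_elt: "k < p - 1 \<Longrightarrow> lin_char a (elt b k) = a ^ k"
  by (simp add: lin_char_def) (simp add: elt_def)

lemma big_char_elt:
  assumes "b < p" "k < p - 1"
  shows "big_char (elt b k) = (if k \<noteq> 0 then 0 else if b = 0 then of_nat (p - 1) else -1)"
  using assms by (simp add: big_char_def) (simp add: elt_def)

lemma char_extensional [simp]:
  "lin_char a \<in> extensional (carrier G)" "big_char \<in> extensional (carrier G)"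
  "rep_character G \<rho> \<in> extensional (carrier G)"
  by (simp_all add: lin_char_def big_char_def rep_character_def)

lemma char_eqI:
  assumes "\<And>b k. b < p \<Longrightarrow> k < p - 1 \<Longrightarrow> f (elt b k) = h (elt b k)"
    and "f \<in> extensional (carrier G)" "h \<in> extensional (carrier G)"
  shows "f = h"
  using assms by (intro extensionalityI[of _ "carrier G"]) (auto elim!: carrier_cases)

text \<open>The condition on \<open>a\<close> makes the power well defined on exponents modulo
  \<open>p - 1\<close>, that is, on the cyclic quotient by the translations. A line has no proper
  nonzero subspace.\<close>

lemma lin_char_irreducible:
  assumes a: "a ^ (p - 1) = 1"
  shows "\<exists>\<rho>. irreducible_rep G 1 \<rho> \<and> lin_char a = rep_character G \<rho>"
proof -
  define \<rho> where "\<rho> = (\<lambda>x. mat 1 1 (\<lambda>_. a ^ snd (prod_decode x)))"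
  have a0: "a \<noteq> 0" using a pos by (auto simp: zero_power)
  have mod: "a ^ (k mod (p - 1)) = a ^ k" for k
  proof -
    have "a ^ k = a ^ ((p - 1) * (k div (p - 1)) + k mod (p - 1))" by simp
    then show ?thesis using a by (simp only: power_add power_mult) simp
  qed
  have \<rho>_elt: "\<rho> (elt b k) = mat 1 1 (\<lambda>_. a ^ k)" for b k
    by (simp add: \<rho>_def elt_def mod)
  have "\<rho> \<in> hom G (GL 1)"
  proof (rule hom_GL_I[OF group_G])
    fix x y assume "x \<in> carrier G" "y \<in> carrier G"
    then show "\<rho> (x \<otimes>\<^bsub>G\<^esub> y) = \<rho> x * \<rho> y"
      by (elim carrier_cases) (auto simp: \<rho>_elt power_add scalar_prod_def intro!: eq_matI)
  next
    show "\<rho> \<one>\<^bsub>G\<^esub> = 1\<^sub>m 1" by (auto simp: \<rho>_elt intro!: eq_matI)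
  qed (simp add: \<rho>_def)
  moreover have "W = carrier_vec 1"
    if inv: "invariant_subspace G 1 \<rho> W" and W: "W \<noteq> {0\<^sub>v 1}" for W
  proof -
    note W' = inv[unfolded invariant_subspace_def subspace_module_vec_iff]
    obtain w where w: "w \<in> W" "w \<noteq> 0\<^sub>v 1" using W W' by auto
    then have wc: "w \<in> carrier_vec 1" using W' by auto
    then have w0: "w $ 0 \<noteq> 0" using w(2) by (auto intro!: eq_vecI)
    have "v \<in> W" if v: "v \<in> carrier_vec 1" for v
    proof -
      have "(v $ 0 / w $ 0) \<cdot>\<^sub>v w \<in> W" using W' w by blast
      also have "(v $ 0 / w $ 0) \<cdot>\<^sub>v w = v" using v wc w0 by (intro eq_vecI) auto
      finally show ?thesis .
    qed
    then show ?thesis using W' by auto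
  qed
  ultimately have irr: "irreducible_rep G 1 \<rho>" by (auto simp: irreducible_rep_def)
  have "lin_char a = rep_character G \<rho>"
    by (rule char_eqI) (auto simp: lin_char_elt rep_character_def \<rho>_elt mat_trace_def)
  with irr show ?thesis by blast
qed

section \<open>The irreducible representation of degree \<open>p - 1\<close>\<close>

definition zeta :: complex where "zeta = cis (2 * pi / real p)"

lemma zeta: "zeta ^ p = 1" "zeta \<noteq> 1"
proof -
  show "zeta ^ p = 1" using pos by (simp add: zeta_def DeMoivre)
  show "zeta \<noteq> 1"
    using inj_onD[OF bij_betw_imp_inj_on[OF bij_betw_roots_unity[OF pos(1)]], of 0 1] pos
    by (auto simp: zeta_def)
qed

lemmas zeta_eq_iff = prime_order_power_eq_iff[OF p zeta]

text \<open>The representation induced from the translation subgroup: the \<open>i\<close>-th basis vector spans the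
  eigenspace on which the translation by \<open>b\<close> acts as \<open>zeta ^ (b * g ^ i)\<close>.\<close>

definition monomial_mat :: "nat \<Rightarrow> nat \<Rightarrow> complex mat" where
  "monomial_mat b k = mat (p - 1) (p - 1)
     (\<lambda>(i, j). if j = (i + k) mod (p - 1) then zeta ^ (b * g ^ i) else 0)"

definition monomial_rep :: "nat \<Rightarrow> complex mat" where
  "monomial_rep x = (case prod_decode x of (b, k) \<Rightarrow> monomial_mat b k)"

text \<open>The matrix depends only on the residues of \<open>b\<close> and \<open>k\<close>, so
  unreduced arguments are harmless here too.\<close>

lemma monomial_rep_elt: "monomial_rep (elt b k) = monomial_mat b k"
proof -
  have "zeta ^ (b mod p * g ^ i) = zeta ^ (b * g ^ i)" for i
    unfolding zeta_eq_iff by (intro cong_mult) (auto simp: cong_def)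
  then show ?thesis
    by (auto simp: monomial_rep_def elt_def monomial_mat_def mod_add_right_eq intro!: eq_matI)
qed

lemma monomial_mat_mult: "monomial_mat b k * monomial_mat c l = monomial_mat (b + g ^ k * c) (k + l)"
proof (rule eq_matI)
  fix i j assume "i < dim_row (monomial_mat (b + g ^ k * c) (k + l))"
    "j < dim_col (monomial_mat (b + g ^ k * c) (k + l))"
  then have ij: "i < p - 1" "j < p - 1" by (auto simp: monomial_mat_def)
  define r where "r = (i + k) mod (p - 1)"
  have r: "r < p - 1" using pos by (simp add: r_def)
  have "(monomial_mat b k * monomial_mat c l) $$ (i, j) =
      (\<Sum>s<p - 1. monomial_mat b k $$ (i, s) * monomial_mat c l $$ (s, j))"
    using ij by (auto simp: monomial_mat_def scalar_prod_def atLeast0LessThan intro!: sum.cong)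
  \<comment> \<open>Row \<open>i\<close> has its only nonzero entry in column \<open>r\<close>, so
    the sum collapses.\<close>
  also have "\<dots> = (\<Sum>s<p - 1. if s = r then zeta ^ (b * g ^ i) * monomial_mat c l $$ (s, j) else 0)"
    using ij by (intro sum.cong refl) (simp add: monomial_mat_def[of b k] r_def)
  also have "\<dots> = zeta ^ (b * g ^ i) * monomial_mat c l $$ (r, j)" using r by simp
  also have "monomial_mat c l $$ (r, j) = (if j = (i + (k + l)) mod (p - 1) then zeta ^ (c * g ^ r) else 0)"
    using ij r by (simp add: monomial_mat_def) (simp add: r_def mod_add_left_eq add.assoc)
  also have "zeta ^ (c * g ^ r) = zeta ^ (c * g ^ (i + k))"
    unfolding zeta_eq_iff by (intro cong_mult) (auto simp: gpow_cong_iff r_def)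
  finally show "(monomial_mat b k * monomial_mat c l) $$ (i, j) =
      monomial_mat (b + g ^ k * c) (k + l) $$ (i, j)"
    using ij by (simp add: monomial_mat_def power_add algebra_simps)
qed (auto simp: monomial_mat_def)

lemma monomial_rep_hom: "monomial_rep \<in> hom G (GL (p - 1))"
proof (rule hom_GL_I[OF group_G])
  fix x y assume "x \<in> carrier G" "y \<in> carrier G"
  then show "monomial_rep (x \<otimes>\<^bsub>G\<^esub> y) = monomial_rep x * monomial_rep y"
    by (elim carrier_cases) (simp add: monomial_rep_elt monomial_mat_mult)
next
  show "monomial_rep \<one>\<^bsub>G\<^esub> = 1\<^sub>m (p - 1)"
    by (auto simp: monomial_rep_elt monomial_mat_def intro!: eq_matI)
qed (auto elim!: carrier_cases simp: monomial_rep_elt monomial_mat_def)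

lemma monomial_mat_mult_vec:
  assumes w: "w \<in> carrier_vec (p - 1)" and r: "r < p - 1"
  shows "(monomial_mat b k *\<^sub>v w) $ r = zeta ^ (b * g ^ r) * w $ ((r + k) mod (p - 1))"
proof -
  have "(monomial_mat b k *\<^sub>v w) $ r = (\<Sum>s<p - 1. monomial_mat b k $$ (r, s) * w $ s)"
    using r w by (auto simp: monomial_mat_def scalar_prod_def atLeast0LessThan intro!: sum.cong)
  also have "\<dots> = (\<Sum>s<p - 1. if s = (r + k) mod (p - 1) then zeta ^ (b * g ^ r) * w $ s else 0)"
    using r by (intro sum.cong refl) (simp add: monomial_mat_def)
  also have "\<dots> = zeta ^ (b * g ^ r) * w $ ((r + k) mod (p - 1))" using pos by simp
  finally show ?thesis .
qed

text \<open>Given a vector of \<open>W\<close> with a nonzero coordinate \<open>i\<close>, a power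
  of the shift moves that coordinate to any place \<open>l\<close>. A weighted sum over the
  translations then kills all other coordinates, since distinct coordinates carry distinct
  characters of the translation group. So \<open>W\<close> contains every unit vector.\<close>

lemma monomial_rep_irreducible: "irreducible_rep G (p - 1) monomial_rep"
  unfolding irreducible_rep_def
proof (intro conjI allI impI monomial_rep_hom pos)
  fix W assume inv: "invariant_subspace G (p - 1) monomial_rep W"
  note W = inv[unfolded invariant_subspace_def subspace_module_vec_iff]
  have sum_closed: "vec (p - 1) (\<lambda>j. \<Sum>i\<in>S. f i $ j) \<in> W" if "finite S" "\<And>i. i \<in> S \<Longrightarrow> f i \<in> W"
    for S :: "nat set" and f using that W by (intro sum_vec_closed) auto
  show "W = {0\<^sub>v (p - 1)} \<or> W = carrier_vec (p - 1)"
  proof (rule disjCI)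
    assume "W \<noteq> carrier_vec (p - 1)"
    have "w = 0\<^sub>v (p - 1)" if w: "w \<in> W" for w
    proof (rule ccontr)
      assume nz: "w \<noteq> 0\<^sub>v (p - 1)"
      have wc: "w \<in> carrier_vec (p - 1)" using w W by auto
      then obtain i where i: "i < p - 1" "w $ i \<noteq> 0" using nz eq_vecI[of "0\<^sub>v (p - 1)" w] by auto
      have unit: "unit_vec (p - 1) l \<in> W" if l: "l < p - 1" for l
      proof -
        \<comment> \<open>The shift by \<open>i - l\<close>, with \<open>p - 1\<close> added to stay
          within the natural numbers.\<close>
        define k where "k = i + (p - 1) - l"
        have k: "(l + k) mod (p - 1) = i" 
        proof -
          have "l + k = (p - 1) + i" using l by (simp add: k_def)
          then show ?thesis using i(1) by (simp only: mod_add_self1 mod_less)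
        qed
        \<comment> \<open>The weight is the inverse of the eigenvalue of the translation by
          \<open>b\<close> at place \<open>l\<close>; summing over \<open>b\<close> gives
          \<open>p\<close> times the projection to that place.\<close>
        define f where "f b = zeta ^ (b * ((p - 1) * g ^ l)) \<cdot>\<^sub>v (monomial_rep (elt b k) *\<^sub>v w)" for b
        have "vec (p - 1) (\<lambda>j. \<Sum>b<p. f b $ j) \<in> W"
          using W w by (intro sum_closed) (auto simp: f_def)
        also have "vec (p - 1) (\<lambda>j. \<Sum>b<p. f b $ j) = (of_nat p * w $ i) \<cdot>\<^sub>v unit_vec (p - 1) l"
        proof (rule eq_vecI)
          fix r assume "r < dim_vec ((of_nat p * w $ i) \<cdot>\<^sub>v unit_vec (p - 1) l)"
          then have r: "r < p - 1" by simp
          \<comment> \<open>Modulo \<open>p\<close> this is \<open>g ^ r - g ^ l\<close>, so the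
            geometric sum below vanishes unless \<open>r = l\<close>.\<close>
          define m where "m = (p - 1) * g ^ l + g ^ r"
          have zm: "(zeta ^ m) ^ p = 1" by (metis power_mult mult.commute power_one zeta(1))
          have "(monomial_rep (elt b k) *\<^sub>v w) $ r = zeta ^ (b * g ^ r) * w $ ((r + k) mod (p - 1))" for b
            unfolding monomial_rep_elt by (rule monomial_mat_mult_vec[OF wc r])
          then have "f b $ r = (zeta ^ m) ^ b * w $ ((r + k) mod (p - 1))" for b
            using r by (simp add: f_def monomial_rep_elt monomial_mat_def m_def power_add
                power_mult[symmetric] algebra_simps)
          then have "(\<Sum>b<p. f b $ r) = (\<Sum>b<p. (zeta ^ m) ^ b) * w $ ((r + k) mod (p - 1))"
            by (simp add: sum_distrib_right)
          also have "(\<Sum>b<p. (zeta ^ m) ^ b) = (if zeta ^ m = zeta ^ 0 then of_nat p else 0)"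
            using sum_powers_root_of_unity[OF zm] by simp
          also have "zeta ^ m = zeta ^ 0 \<longleftrightarrow> r = l"
          proof -
            have "zeta ^ m = zeta ^ 0 \<longleftrightarrow> [m + g ^ l = 0 + g ^ l] (mod p)"
              unfolding zeta_eq_iff by (simp only: cong_add_rcancel_nat)
            also have "m + g ^ l = p * g ^ l + g ^ r"
              by (simp only: m_def add_ac pred_mult_add[symmetric])
            also have "[\<dots> = 0 + g ^ l] (mod p) \<longleftrightarrow> [g ^ r = g ^ l] (mod p)"
              by (simp add: cong_def)
            also have "\<dots> \<longleftrightarrow> r = l" using r l
              by (auto simp: gpow_cong_iff cong_less_modulus_unique_nat)
            finally show ?thesis .
          qed
          finally show "vec (p - 1) (\<lambda>j. \<Sum>b<p. f b $ j) $ r =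
              ((of_nat p * w $ i) \<cdot>\<^sub>v unit_vec (p - 1) l) $ r"
            using r l k by auto
        qed simp
        finally have "(1 / (of_nat p * w $ i)) \<cdot>\<^sub>v ((of_nat p * w $ i) \<cdot>\<^sub>v unit_vec (p - 1) l) \<in> W"
          using W by blast
        then show ?thesis using i pos by (simp add: smult_smult_assoc)
      qed
      have "v \<in> W" if v: "v \<in> carrier_vec (p - 1)" for v
      proof -
        have "vec (p - 1) (\<lambda>j. \<Sum>l<p - 1. (v $ l \<cdot>\<^sub>v unit_vec (p - 1) l) $ j) \<in> W"
          using unit W by (intro sum_closed) auto
        also have "vec (p - 1) (\<lambda>j. \<Sum>l<p - 1. (v $ l \<cdot>\<^sub>v unit_vec (p - 1) l) $ j) = v"
          using v by (intro eq_vecI) (auto simp: unit_vec_def if_distrib[of "\<lambda>x. _ * x"] cong: if_cong)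
        finally show ?thesis .
      qed
      then show False using W \<open>W \<noteq> carrier_vec (p - 1)\<close> by auto
    qed
    then show "W = {0\<^sub>v (p - 1)}" using W by auto
  qed
qed

section \<open>Classification of the irreducible characters\<close>

context
  fixes n \<rho>
  assumes irr: "irreducible_rep G n \<rho>"
begin

lemma rep_hom: "\<rho> \<in> hom G (GL n)" and dim_pos: "n > 0"
  using irr by (auto simp: irreducible_rep_def)

lemma rep_carrier [simp]: "\<rho> (elt b k) \<in> carrier_mat n n"
  by (rule hom_GL_carrier[OF rep_hom elt_in])

lemma rep_vec_carrier [simp]: "v \<in> carrier_vec n \<Longrightarrow> \<rho> (elt b k) *\<^sub>v v \<in> carrier_vec n"
  by (rule mult_mat_vec_carrier[OF rep_carrier])

lemma rep_act:
  assumes "v \<in> carrier_vec n"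
  shows "\<rho> (elt b k) *\<^sub>v (\<rho> (elt c l) *\<^sub>v v) = \<rho> (elt (b + g ^ k * c) (k + l)) *\<^sub>v v"
  using hom_GL_mult_vec[OF rep_hom elt_in elt_in assms] by simp

lemma rep_one: "\<rho> (elt 0 0) = 1\<^sub>m n"
  using hom_GL_one[OF group_G rep_hom] by simp

lemma rep_smult:
  "v \<in> carrier_vec n \<Longrightarrow> \<rho> (elt b k) *\<^sub>v (a \<cdot>\<^sub>v v) = a \<cdot>\<^sub>v (\<rho> (elt b k) *\<^sub>v v)"
  by (rule mult_mat_vec[OF rep_carrier])

lemma rep_zero: "\<rho> (elt b k) *\<^sub>v 0\<^sub>v n = 0\<^sub>v n"
  using carrier_matD[OF rep_carrier[of b k]] by (intro eq_vecI) auto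

definition transl_fixed :: "complex vec set" where
  "transl_fixed = {v \<in> carrier_vec n. \<forall>b. \<rho> (elt b 0) *\<^sub>v v = v}"

text \<open>Normality of the translations: the translation by \<open>b\<close> after
  \<open>x\<close> equals \<open>x\<close> after the translation by \<open>d\<close>, where
  \<open>g ^ k * d\<close> is \<open>b\<close> modulo \<open>p\<close>.\<close>

lemma transl_fixed_invariant: "invariant_subspace G n \<rho> transl_fixed"
  unfolding invariant_subspace_def subspace_module_vec_iff
proof (intro conjI ballI allI)
  fix v w assume "v \<in> transl_fixed" "w \<in> transl_fixed"
  then show "v + w \<in> transl_fixed"
    using mult_add_distrib_mat_vec[OF rep_carrier] by (auto simp: transl_fixed_def)
next
  fix a v assume "v \<in> transl_fixed"
  then show "a \<cdot>\<^sub>v v \<in> transl_fixed" by (auto simp: transl_fixed_def rep_smult)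
next
  fix x v assume x: "x \<in> carrier G" and "v \<in> transl_fixed"
  then have v: "v \<in> carrier_vec n" "\<And>b. \<rho> (elt b 0) *\<^sub>v v = v" by (auto simp: transl_fixed_def)
  obtain c k where ck: "x = elt c k" using x by (rule carrier_cases)
  have "\<rho> (elt b 0) *\<^sub>v (\<rho> x *\<^sub>v v) = \<rho> x *\<^sub>v v" for b
  proof -
    obtain d where d: "[g ^ k * d = b] (mod p)" by (rule ex_gpow_div)
    have "[b + c = c + g ^ k * d] (mod p)"
      using cong_add[OF cong_refl[of c] cong_sym[OF d]] by (simp add: add.commute)
    then have "elt (b + c) k = elt (c + g ^ k * d) k" by (auto intro: elt_eqI)
    then have "\<rho> (elt b 0) *\<^sub>v (\<rho> x *\<^sub>v v) = \<rho> x *\<^sub>v (\<rho> (elt d 0) *\<^sub>v v)"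
      using v(1) by (simp add: ck rep_act)
    then show ?thesis using v(2) by simp
  qed
  then show "\<rho> x *\<^sub>v v \<in> transl_fixed" using v by (auto simp: transl_fixed_def ck)
next
  show "0\<^sub>v n \<in> transl_fixed"
    by (simp add: transl_fixed_def rep_zero)
qed (auto simp: transl_fixed_def)

lemma transl_fixed_cases: "transl_fixed = {0\<^sub>v n} \<or> transl_fixed = carrier_vec n"
  using irr transl_fixed_invariant by (auto simp: irreducible_rep_def)

text \<open>As translations act trivially, an eigenvector of the generator \<open>elt 0 1\<close> of
  the dilations is a common eigenvector of the group. Its line is invariant, so the dimension is
  \<open>1\<close> and the eigenvalue is the parameter \<open>a\<close>.\<close>

lemma linear_if_transl_fixed:
  assumes all: "transl_fixed = carrier_vec n"
  shows "\<exists>a. a ^ (p - 1) = 1 \<and> rep_character G \<rho> = lin_char a"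
proof -
  obtain v a where v: "v \<in> carrier_vec n" "v \<noteq> 0\<^sub>v n" "\<rho> (elt 0 1) *\<^sub>v v = a \<cdot>\<^sub>v v"
    using complex_mat_has_eigenvector[OF rep_carrier dim_pos] by metis
  have pow: "\<rho> (elt 0 k) *\<^sub>v v = a ^ k \<cdot>\<^sub>v v" for k
  proof (induction k)
    case (Suc k)
    have "\<rho> (elt 0 (Suc k)) *\<^sub>v v = \<rho> (elt 0 k) *\<^sub>v (\<rho> (elt 0 1) *\<^sub>v v)"
      using v(1) by (simp add: rep_act Suc_eq_plus1)
    then show ?case using v(1) Suc by (simp add: v(3) rep_smult smult_smult_assoc)
  qed (use v rep_one in simp)
  have act: "\<rho> (elt b k) *\<^sub>v v = a ^ k \<cdot>\<^sub>v v" for b k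
  proof -
    have "\<rho> (elt b k) *\<^sub>v v = \<rho> (elt b 0) *\<^sub>v (\<rho> (elt 0 k) *\<^sub>v v)"
      using v(1) by (simp add: rep_act)
    also have "\<dots> = \<rho> (elt 0 k) *\<^sub>v v"
      using all rep_vec_carrier[OF v(1)] by (auto simp: transl_fixed_def)
    finally show ?thesis by (simp add: pow)
  qed
  have "n \<le> 1"
  proof (rule irreducible_rep_dim_le[OF irr, where f = "\<lambda>_. v" and s = 0])
    fix x assume "x \<in> carrier G"
    then obtain b k where x: "x = elt b k" by (rule carrier_cases)
    show "\<exists>j<1::nat. \<exists>c. \<rho> x *\<^sub>v v = c \<cdot>\<^sub>v v"
      by (intro exI[of _ 0] conjI exI[of _ "a ^ k"]) (simp_all add: x act)
  qed (use v in auto)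
  then have n: "n = 1" using dim_pos by simp
  have v0: "v $ 0 \<noteq> 0" using v(1,2) eq_vecI[of "0\<^sub>v n" v] by (auto simp: n)
  have trace: "mat_trace (\<rho> (elt b k)) = a ^ k" for b k
  proof -
    have "\<rho> (elt b k) $$ (0, 0) * v $ 0 = (\<rho> (elt b k) *\<^sub>v v) $ 0"
      using rep_carrier[of b k] v(1) by (simp add: n scalar_prod_def One_nat_def)
    also have "\<dots> = a ^ k * v $ 0" using v(1) by (simp add: act n)
    finally have "\<rho> (elt b k) $$ (0, 0) = a ^ k" using v0 by simp
    then show ?thesis using carrier_matD[OF rep_carrier[of b k]] by (simp add: mat_trace_def n)
  qed
  have "elt 0 (p - 1) = elt 0 0" by (rule elt_eqI) (auto simp: cong_0_iff)
  then have "a ^ (p - 1) = 1" using trace[of 0 0] trace[of 0 "p - 1"] by simp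
  moreover have "rep_character G \<rho> = lin_char a"
    by (rule char_eqI) (auto simp: lin_char_elt rep_character_def trace)
  ultimately show ?thesis by blast
qed

text \<open>Dilations conjugate all nontrivial translations into each other. For
  \<open>g ^ k\<close> different from \<open>1\<close>, conjugation by the translation by
  \<open>c\<close> moves the translation part by \<open>(1 - g ^ k) * c\<close>, which takes every
  value, so the whole coset is one class.\<close>

lemma rep_character_const:
  "[g ^ k = b] (mod p) \<Longrightarrow> rep_character G \<rho> (elt b 0) = rep_character G \<rho> (elt 1 0)"
  "\<not> [k = 0] (mod (p - 1)) \<Longrightarrow> rep_character G \<rho> (elt b k) = rep_character G \<rho> (elt 0 k)"
proof -
  note comm = rep_character_mult_comm[OF group_G rep_hom elt_in elt_in]
  show "rep_character G \<rho> (elt b 0) = rep_character G \<rho> (elt 1 0)" if "[g ^ k = b] (mod p)"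
  proof -
    obtain l where l: "[k + l = 0] (mod (p - 1))" by (rule ex_neg_exp)
    have "elt 0 k \<otimes>\<^bsub>G\<^esub> elt 1 l = elt b 0" "elt 1 l \<otimes>\<^bsub>G\<^esub> elt 0 k = elt 1 0"
      using that l by (auto intro!: elt_eqI simp: add.commute)
    then show ?thesis using comm[of 0 k 1 l] by simp
  qed
  show "rep_character G \<rho> (elt b k) = rep_character G \<rho> (elt 0 k)" if k: "\<not> [k = 0] (mod (p - 1))"
  proof -
    \<comment> \<open>This represents \<open>1 - g ^ k\<close>, which is invertible modulo
      \<open>p\<close> by the assumption on \<open>k\<close>.\<close>
    define u where "u = 1 + (p - 1) * g ^ k"
    have "\<not> p dvd u"
    proof
      assume "p dvd u"
      then have "[u + g ^ k = 0 + g ^ k] (mod p)" by (intro cong_add) (auto simp: cong_0_iff)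
      also have "u + g ^ k = 1 + p * g ^ k" by (simp only: u_def add.assoc pred_mult_add)
      finally have "[g ^ k = g ^ 0] (mod p)" by (simp add: cong_def)
      then show False using k by (simp only: gpow_cong_iff)
    qed
    then obtain j where "[g ^ j = u] (mod p)" by (rule ex_gpow_cong)
    moreover obtain c where "[g ^ j * c = b] (mod p)" by (rule ex_gpow_div)
    ultimately have c: "[u * c = b] (mod p)" by (meson cong_scalar_right cong_sym cong_trans)
    \<comment> \<open>With \<open>d\<close> representing minus \<open>g ^ k * c\<close>, the two
      products of \<open>elt c 0\<close> and \<open>elt d k\<close> have translation parts
      \<open>u * c\<close>, which is \<open>b\<close>, and \<open>0\<close>.\<close>
    define d where "d = (p - 1) * (g ^ k * c)"
    have "c + d = u * c" by (simp add: u_def d_def algebra_simps)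
    then have "elt c 0 \<otimes>\<^bsub>G\<^esub> elt d k = elt b k" using c by (auto intro!: elt_eqI)
    moreover have "d + g ^ k * c = p * (g ^ k * c)" by (simp only: d_def pred_mult_add)
    then have "elt d k \<otimes>\<^bsub>G\<^esub> elt c 0 = elt 0 k" by (auto intro!: elt_eqI simp: cong_0_iff)
    ultimately show ?thesis using comm[of c 0 d k] by simp
  qed
qed

text \<open>The sum of all translation operators maps every vector to a fixed vector. Applied to a
  unit vector, it yields column \<open>j\<close>.\<close>

lemma sum_transl_zero:
  assumes zero: "transl_fixed = {0\<^sub>v n}" and i: "i < n" and j: "j < n"
  shows "(\<Sum>b<p. \<rho> (elt b 0) $$ (i, j)) = 0"
proof -
  define v :: "complex vec" where "v = unit_vec n j"
  have v: "v \<in> carrier_vec n" by (simp add: v_def)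
  define s where "s = vec n (\<lambda>i. \<Sum>b<p. (\<rho> (elt b 0) *\<^sub>v v) $ i)"
  have "\<rho> (elt c 0) *\<^sub>v s = s" for c
  proof -
    have "\<rho> (elt c 0) *\<^sub>v s = vec n (\<lambda>i. \<Sum>b<p. (\<rho> (elt c 0) *\<^sub>v (\<rho> (elt b 0) *\<^sub>v v)) $ i)"
      unfolding s_def by (rule mult_mat_vec_sum[OF rep_carrier]) (simp add: v)
    also have "\<dots> = vec n (\<lambda>i. \<Sum>b<p. (\<rho> (elt ((c + b) mod p) 0) *\<^sub>v v) $ i)"
    proof -
      have "elt (c + b) 0 = elt ((c + b) mod p) 0" for b by (simp add: elt_def)
      then show ?thesis by (simp add: rep_act v)
    qed
    also have "\<dots> = s"
      unfolding s_def by (simp add: sum_shift_mod[OF pos(1), of "\<lambda>b. (\<rho> (elt b 0) *\<^sub>v v) $ _"])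
    finally show ?thesis .
  qed
  then have "s \<in> transl_fixed" by (simp add: transl_fixed_def s_def)
  then have "s $ i = 0" using zero i by simp
  moreover have "(\<rho> (elt b 0) *\<^sub>v v) $ i = \<rho> (elt b 0) $$ (i, j)" for b
    using i j carrier_matD[OF rep_carrier[of b 0]] by (simp add: v_def)
  ultimately show ?thesis using i by (simp add: s_def)
qed

text \<open>Every element of the coset is a translation times \<open>elt 0 k\<close>; the trace is
  linear in the first factor, and the translation operators sum to zero.\<close>

lemma sum_character_coset_zero:
  assumes zero: "transl_fixed = {0\<^sub>v n}"
  shows "(\<Sum>b<p. rep_character G \<rho> (elt b k)) = 0"
proof -
  have "rep_character G \<rho> (elt b k) = (\<Sum>i<n. \<Sum>j<n. \<rho> (elt b 0) $$ (i, j) * \<rho> (elt 0 k) $$ (j, i))" for b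
  proof -
    have "\<rho> (elt b k) = \<rho> (elt b 0) * \<rho> (elt 0 k)"
      using hom_GL_mult[OF rep_hom elt_in elt_in, of b 0 0 k] by simp
    then show ?thesis by (simp add: rep_character_def mat_trace_mult[OF rep_carrier rep_carrier])
  qed
  then have "(\<Sum>b<p. rep_character G \<rho> (elt b k)) =
      (\<Sum>b<p. \<Sum>i<n. \<Sum>j<n. \<rho> (elt b 0) $$ (i, j) * \<rho> (elt 0 k) $$ (j, i))" by simp
  also have "\<dots> = (\<Sum>i<n. \<Sum>b<p. \<Sum>j<n. \<rho> (elt b 0) $$ (i, j) * \<rho> (elt 0 k) $$ (j, i))"
    by (rule sum.swap)
  also have "\<dots> = (\<Sum>i<n. \<Sum>j<n. \<Sum>b<p. \<rho> (elt b 0) $$ (i, j) * \<rho> (elt 0 k) $$ (j, i))"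
    by (rule sum.cong[OF refl], rule sum.swap)
  also have "\<dots> = (\<Sum>i<n. \<Sum>j<n. 0)"
    by (intro sum.cong refl) (simp add: sum_distrib_right[symmetric] sum_transl_zero[OF zero])
  finally show ?thesis by simp
qed

text \<open>An eigenvector \<open>v\<close> of the translation by \<open>1\<close> has eigenvalue
  \<open>z\<close> different from \<open>1\<close>, else all translations would fix it. Its
  \<open>p - 1\<close> images under dilations are permuted up to scalars by the group, which bounds
  \<open>n\<close> above. They are again eigenvectors, with every nontrivial power of
  \<open>z\<close> as eigenvalue, which bounds \<open>n\<close> below.\<close>

lemma dim_if_transl_fixed_zero:
  assumes zero: "transl_fixed = {0\<^sub>v n}"
  shows "n = p - 1"
proof -
  obtain v z where v: "v \<in> carrier_vec n" "v \<noteq> 0\<^sub>v n" "\<rho> (elt 1 0) *\<^sub>v v = z \<cdot>\<^sub>v v"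
    using complex_mat_has_eigenvector[OF rep_carrier dim_pos] by metis
  have pow: "\<rho> (elt b 0) *\<^sub>v v = z ^ b \<cdot>\<^sub>v v" for b
  proof (induction b)
    case (Suc b)
    have "\<rho> (elt (Suc b) 0) *\<^sub>v v = \<rho> (elt b 0) *\<^sub>v (\<rho> (elt 1 0) *\<^sub>v v)"
      using v(1) by (simp add: rep_act Suc_eq_plus1)
    then show ?case using v(1) Suc by (simp add: v(3) rep_smult smult_smult_assoc)
  qed (use v rep_one in simp)
  have "z \<noteq> 1"
  proof
    assume "z = 1"
    then have "v \<in> transl_fixed" using v by (simp add: transl_fixed_def pow)
    then show False using zero v by simp
  qed
  have "z ^ p = 1"
  proof -
    have "elt p 0 = elt 0 0" by (rule elt_eqI) (auto simp: cong_0_iff)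
    then have "z ^ p \<cdot>\<^sub>v v = v" using pow[of p] pow[of 0] v by simp
    moreover obtain i where "i < n" "v $ i \<noteq> 0" using v(1,2) eq_vecI[of "0\<^sub>v n" v] by auto
    ultimately have "z ^ p * v $ i = v $ i"
      using v(1) by (metis carrier_vecD index_smult_vec(1))
    then show ?thesis using \<open>v $ i \<noteq> 0\<close> by simp
  qed
  note z_eq_iff = prime_order_power_eq_iff[OF p \<open>z ^ p = 1\<close> \<open>z \<noteq> 1\<close>]
  define f where "f k = \<rho> (elt 0 k) *\<^sub>v v" for k
  have f_carrier [simp]: "f k \<in> carrier_vec n" for k using v by (simp add: f_def)
  have f_act: "\<exists>a. \<rho> (elt b k) *\<^sub>v f i = a \<cdot>\<^sub>v f (k + i)" for b k i
  proof -
    \<comment> \<open>The translation by \<open>b\<close> is moved past the dilation, becoming the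
      translation by \<open>c\<close>, which acts on \<open>v\<close> as a scalar.\<close>
    obtain c where "[g ^ (k + i) * c = b] (mod p)" by (rule ex_gpow_div)
    then have "elt b (k + i) = elt (g ^ (k + i) * c) (k + i)" by (auto intro: elt_eqI cong_sym)
    then have "\<rho> (elt b k) *\<^sub>v f i = \<rho> (elt 0 (k + i)) *\<^sub>v (\<rho> (elt c 0) *\<^sub>v v)"
      using v(1) by (simp add: f_def rep_act)
    then show ?thesis using v(1) by (auto simp: pow rep_smult f_def)
  qed
  have f_mod: "f (k mod (p - 1)) = f k" for k by (simp add: f_def elt_def)
  have f_0: "f 0 = v" using v by (simp add: f_def rep_one)
  have f_nz: "f k \<noteq> 0\<^sub>v n" for k
  proof
    assume f0: "f k = 0\<^sub>v n"
    obtain l where l: "[k + l = 0] (mod (p - 1))" by (rule ex_neg_exp)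
    have "elt 0 (l + k) = elt 0 0" using l by (auto intro: elt_eqI simp: add.commute)
    then have "\<rho> (elt 0 l) *\<^sub>v f k = v" using v by (simp add: f_def rep_act rep_one)
    then show False using f0 v(2) by (simp add: rep_zero)
  qed
  have "n \<le> p - 1"
  proof (rule irreducible_rep_dim_le[OF irr, where f = f and s = 0])
    fix x i assume "x \<in> carrier G"
    then obtain b k where x: "x = elt b k" by (rule carrier_cases)
    obtain a where "\<rho> x *\<^sub>v f i = a \<cdot>\<^sub>v f ((k + i) mod (p - 1))"
      using f_act[of b k i] by (auto simp: x f_mod)
    then show "\<exists>j<p - 1. \<exists>a. \<rho> x *\<^sub>v f i = a \<cdot>\<^sub>v f j"
      using pos by (intro exI[of _ "(k + i) mod (p - 1)"] conjI exI[of _ a]) auto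
  qed (use f_nz pos in auto)
  moreover have "p - 1 \<le> n"
  proof -
    have "inj_on (\<lambda>b. z ^ b) {1..<p}"
      by (auto simp: inj_on_def z_eq_iff cong_less_modulus_unique_nat)
    then have "p - 1 = card ((\<lambda>b. z ^ b) ` {1..<p})" by (simp add: card_image)
    also have "\<dots> \<le> n"
    proof (rule card_eigenvalues_le[OF rep_carrier])
      fix y assume "y \<in> (\<lambda>b. z ^ b) ` {1..<p}"
      then obtain b where b: "y = z ^ b" "0 < b" "b < p" by auto
      then have "\<not> p dvd b" by (auto dest: dvd_imp_le)
      then obtain j where j: "[g ^ j = b] (mod p)" by (rule ex_gpow_cong)
      \<comment> \<open>This \<open>k\<close> makes \<open>g ^ k * b\<close> congruent to
        \<open>1\<close>, so the translation by \<open>1\<close> acts on \<open>f k\<close> as the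
        translation by \<open>b\<close> acts on \<open>v\<close>.\<close>
      obtain k where k: "[j + k = 0] (mod (p - 1))" by (rule ex_neg_exp)
      then have "[g ^ (k + j) = g ^ 0] (mod p)" by (simp only: gpow_cong_iff add.commute)
      moreover have "[g ^ k * b = g ^ k * g ^ j] (mod p)" using j by (intro cong_mult) (auto intro: cong_sym)
      ultimately have "[1 = g ^ k * b] (mod p)" by (auto simp: power_add cong_def)
      then have "elt 1 k = elt (g ^ k * b) k" by (auto intro: elt_eqI)
      then have "\<rho> (elt 1 0) *\<^sub>v f k = \<rho> (elt 0 k) *\<^sub>v (\<rho> (elt b 0) *\<^sub>v v)"
        using v(1) by (simp add: f_def rep_act)
      also have "\<dots> = y \<cdot>\<^sub>v f k" using v(1) by (simp add: pow rep_smult f_def b)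
      finally show "eigenvalue (\<rho> (elt 1 0)) y"
        unfolding eigenvalue_def eigenvector_def carrier_matD(1)[OF rep_carrier]
        using f_nz[of k] by (intro exI[of _ "f k"]) simp
    qed
    finally show ?thesis .
  qed
  ultimately show ?thesis by simp
qed

text \<open>The sum over each coset of the translations is zero. On the translations it reads
  \<open>(p - 1) + (p - 1) * t = 0\<close>, with \<open>t\<close> the common nontrivial value; on
  any other coset it is \<open>p\<close> times the constant value.\<close>

lemma big_char_if_transl_fixed_zero:
  assumes zero: "transl_fixed = {0\<^sub>v n}"
  shows "rep_character G \<rho> = big_char"
proof (rule char_eqI)
  fix b k assume b: "b < p" and k: "k < p - 1"
  let ?\<chi> = "rep_character G \<rho>"
  note n = dim_if_transl_fixed_zero[OF zero]
  have one: "?\<chi> (elt 0 0) = of_nat (p - 1)"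
    using rep_character_one[OF group_G rep_hom] n by simp
  have cong: "?\<chi> (elt c 0) = ?\<chi> (elt 1 0)" if c: "c \<in> {1..<p}" for c
  proof -
    have "\<not> p dvd c" using c by (auto dest: dvd_imp_le)
    then show ?thesis using ex_gpow_cong rep_character_const(1) by metis
  qed
  have "0 = (\<Sum>c<p. ?\<chi> (elt c 0))" using sum_character_coset_zero[OF zero] by simp
  also have "{..<p} = insert 0 {1..<p}" using pos by auto
  also have "(\<Sum>c\<in>insert 0 {1..<p}. ?\<chi> (elt c 0)) = of_nat (p - 1) + (\<Sum>c\<in>{1..<p}. ?\<chi> (elt 1 0))"
  proof -
    have "(\<Sum>c\<in>{1..<p}. ?\<chi> (elt c 0)) = (\<Sum>c\<in>{1..<p}. ?\<chi> (elt 1 0))"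
      by (rule sum.cong[OF refl cong])
    then show ?thesis by (simp add: one)
  qed
  also have "\<dots> = of_nat (p - 1) * (1 + ?\<chi> (elt 1 0))" by (simp add: algebra_simps)
  finally have transl: "?\<chi> (elt 1 0) = -1"
    using pos(2) by (metis add_eq_0_iff mult_eq_0_iff of_nat_eq_0_iff not_gr_zero)
  show "?\<chi> (elt b k) = big_char (elt b k)"
  proof (cases "k = 0")
    case True
    then show ?thesis using b k one transl cong[of b] by (auto simp: big_char_elt)
  next
    case False
    then have "\<not> [k = 0] (mod (p - 1))" 
      using k pos(3) cong_less_modulus_unique_nat[of k 0 "p - 1"] by auto
    note const = rep_character_const(2)[OF this]
    have "0 = (\<Sum>c<p. ?\<chi> (elt c k))" using sum_character_coset_zero[OF zero] by simp
    also have "\<dots> = (\<Sum>c<p. ?\<chi> (elt 0 k))" by (intro sum.cong refl const)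
    finally have "?\<chi> (elt 0 k) = 0" using pos by simp
    then show ?thesis using const[of b] b k False by (simp add: big_char_elt)
  qed
qed auto

lemma rep_character_cases:
  "(\<exists>a. a ^ (p - 1) = 1 \<and> rep_character G \<rho> = lin_char a) \<or> rep_character G \<rho> = big_char"
  using transl_fixed_cases linear_if_transl_fixed big_char_if_transl_fixed_zero by blast

end

section \<open>The complete list of irreducible characters with their degrees\<close>

lemma lin_char_neq_big_char: "lin_char a \<noteq> big_char"
proof
  assume "lin_char a = big_char"
  then have "lin_char a (elt 0 0) = big_char (elt 0 0)" by simp
  then have "(1 :: complex) = of_nat (p - 1)" using pos by (simp add: lin_char_elt big_char_elt)
  then have "p - 1 = 1" by (metis of_nat_1 of_nat_eq_iff)
  then show False using p_gt_2 by simp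
qed

text \<open>No trace is computed: the classification leaves only \<open>big_char\<close>, because
  the degree \<open>p - 1\<close> exceeds \<open>1\<close>.\<close>

lemma rep_character_monomial_rep: "rep_character G monomial_rep = big_char"
proof -
  have "rep_character G monomial_rep \<noteq> lin_char a" for a
  proof
    assume "rep_character G monomial_rep = lin_char a"
    then have "rep_character G monomial_rep \<one>\<^bsub>G\<^esub> = lin_char a (elt 0 0)" by simp
    then have "of_nat (p - 1) = (1 :: complex)"
      using rep_character_one[OF group_G monomial_rep_hom] pos by (simp add: lin_char_elt)
    then have "p - 1 = 1" by (metis of_nat_1 of_nat_eq_iff)
    then show False using p_gt_2 by simp
  qed
  then show ?thesis using rep_character_cases[OF monomial_rep_irreducible] by blast
qed

lemma Irr_G: "Irr G = lin_char ` {a. a ^ (p - 1) = 1} \<union> {big_char}"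
proof
  show "Irr G \<subseteq> lin_char ` {a. a ^ (p - 1) = 1} \<union> {big_char}"
    using rep_character_cases by (auto simp: Irr_def)
  show "lin_char ` {a. a ^ (p - 1) = 1} \<union> {big_char} \<subseteq> Irr G"
    using lin_char_irreducible monomial_rep_irreducible rep_character_monomial_rep
    unfolding Irr_def by fastforce
qed

lemma char_degree_lin_char: "a ^ (p - 1) = 1 \<Longrightarrow> char_degree G (lin_char a) = 1"
  using lin_char_irreducible char_degree_eq[OF group_G] by metis

lemma char_degree_big_char: "char_degree G big_char = p - 1"
  using char_degree_eq[OF group_G monomial_rep_irreducible] by (simp add: rep_character_monomial_rep)

lemma inj_lin_char: "inj_on lin_char A"
proof (rule inj_onI)
  fix a b assume "lin_char a = lin_char b"
  then have "lin_char a (elt 0 1) = lin_char b (elt 0 1)" by simp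
  then show "a = b" using p_gt_2 by (simp add: lin_char_elt)
qed

lemma finite_roots: "finite {a :: complex. a ^ (p - 1) = 1}"
  using finite_roots_unity[of "p - 1"] pos by simp

lemma finite_Irr_G: "finite (Irr G)"
  by (simp add: Irr_G finite_roots)

lemma max_degree: "p - 1 \<le> Max (char_degree G ` Irr G)"
proof (rule Max_ge)
  show "p - 1 \<in> char_degree G ` Irr G"
    by (rule image_eqI[of _ _ big_char]) (auto simp: char_degree_big_char Irr_G)
qed (simp add: finite_Irr_G)

text \<open>The linear characters contribute by orthogonality of roots of unity, and
  \<open>big_char\<close> is the remaining summand.\<close>

lemma sum_characters:
  assumes "b < p" "k < p - 1" "c < p" "l < p - 1"
  shows "(\<Sum>\<chi>\<in>Irr G. (of_nat (char_degree G \<chi>))\<^sup>2 * \<chi> (elt b k) * cnj (\<chi> (elt c l))) =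
    (if k = l then of_nat (p - 1) else 0) +
    (of_nat (p - 1))\<^sup>2 * big_char (elt b k) * cnj (big_char (elt c l))"
proof -
  have "(\<Sum>\<chi>\<in>lin_char ` {a. a ^ (p - 1) = 1}.
        (of_nat (char_degree G \<chi>))\<^sup>2 * \<chi> (elt b k) * cnj (\<chi> (elt c l))) =
      (\<Sum>a | a ^ (p - 1) = 1. a ^ k * cnj (a ^ l))"
    using assms
    by (subst sum.reindex[OF inj_lin_char]) (auto simp: char_degree_lin_char lin_char_elt intro!: sum.cong)
  also have "\<dots> = (if k = l then of_nat (p - 1) else 0)"
    by (rule roots_of_unity_orthogonal[OF assms(2,4)])
  finally show ?thesis
    unfolding Irr_G using finite_roots lin_char_neq_big_char lin_char_neq_big_char[THEN not_sym]
    by (subst sum.union_disjoint) (auto simp: char_degree_big_char)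
qed

section \<open>The amenability constant\<close>

text \<open>The kernel \<open>K\<close> vanishes between different cosets of the translations and is
  constantly \<open>m = p - 1\<close> within each nontrivial coset. Only the translations need a
  case distinction, by whether each argument is the identity.\<close>

lemma AM_Z_G: "AM_Z G = 5 - 8 / real p"
proof -
  define m where "m = real (p - 1)"
  have p_m: "real p = m + 1" using pos by (simp add: m_def of_nat_diff)
  have m_pos: "m > 0" using pos by (simp add: m_def)
  define K where "K x y = cmod (\<Sum>\<chi>\<in>Irr G. (of_nat (char_degree G \<chi>))\<^sup>2 * \<chi> x * cnj (\<chi> y))" for x y
  \<comment> \<open>The values of \<open>big_char\<close> on the translations.\<close>
  define h where "h b = (if b = 0 then m else -1)" for b :: nat
  have K: "K (elt b k) (elt c l) =
      (if k \<noteq> l then 0 else if k \<noteq> 0 then m else \<bar>m + m\<^sup>2 * h b * h c\<bar>)"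
    if "b < p" "k < p - 1" "c < p" "l < p - 1" for b k c l
  proof -
    have "(\<Sum>\<chi>\<in>Irr G. (of_nat (char_degree G \<chi>))\<^sup>2 * \<chi> (elt b k) * cnj (\<chi> (elt c l))) =
       of_real (if k \<noteq> l then 0 else if k \<noteq> 0 then m else m + m\<^sup>2 * h b * h c)"
      using that by (auto simp: sum_characters big_char_elt h_def m_def)
    then show ?thesis using m_pos by (auto simp: K_def simp del: of_real_add of_real_mult)
  qed
  have inner: "(\<Sum>l<p - 1. \<Sum>c<p. K (elt b k) (elt c l)) =
      (if k \<noteq> 0 then (m + 1) * m else \<Sum>c<p. \<bar>m + m\<^sup>2 * h b * h c\<bar>)"
    if bk: "b < p" "k < p - 1" for b k
  proof -
    have "(\<Sum>l<p - 1. \<Sum>c<p. K (elt b k) (elt c l)) =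
       (\<Sum>l<p - 1. if l = k then \<Sum>c<p. if k \<noteq> 0 then m else \<bar>m + m\<^sup>2 * h b * h c\<bar> else 0)"
      using bk by (intro sum.cong refl) (auto simp: K)
    then show ?thesis using bk by (simp add: p_m)
  qed
  have split: "(\<Sum>c<p. F (h c)) = F m + m * F (-1)" for F :: "real \<Rightarrow> real"
  proof -
    have "{..<p} = insert 0 {1..<p}" using pos by auto
    then have "(\<Sum>c<p. F (h c)) = F (h 0) + (\<Sum>c\<in>{1..<p}. F (h c))" by simp
    also have "(\<Sum>c\<in>{1..<p}. F (h c)) = (\<Sum>c\<in>{1..<p}. F (-1))"
      by (intro sum.cong) (auto simp: h_def)
    finally show ?thesis by (simp add: h_def m_def)
  qed
  have m1: "m \<ge> 1" using pos by (simp add: m_def)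
  define T where "T k = (\<Sum>b<p. if k \<noteq> 0 then (m + 1) * m else \<Sum>c<p. \<bar>m + m\<^sup>2 * h b * h c\<bar>)"
    for k :: nat
  have "(\<Sum>x\<in>carrier G. \<Sum>y\<in>carrier G. K x y) = (\<Sum>k<p - 1. T k)"
    by (simp add: sum_G inner T_def)
  also have "{..<p - 1} = insert 0 {1..<p - 1}" using pos by auto
  \<comment> \<open>Coset \<open>0\<close> consists of the translations; the other
    \<open>m - 1\<close> cosets contribute \<open>(m + 1)\<^sup>2 * m\<close> each.\<close>
  also have "(\<Sum>k\<in>insert 0 {1..<p - 1}. T k) = T 0 + (\<Sum>k\<in>{1..<p - 1}. T k)" by simp
  also have "T 0 = (\<Sum>b<p. \<Sum>c<p. \<bar>m + m\<^sup>2 * h b * h c\<bar>)" by (simp add: T_def)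
  also have "(\<Sum>k\<in>{1..<p - 1}. T k) = (\<Sum>k\<in>{1..<p - 1}. \<Sum>b<p. (m + 1) * m)"
    by (rule sum.cong[OF refl]) (simp add: T_def)
  also have "(\<Sum>k\<in>{1..<p - 1}. \<Sum>b<p. (m + 1) * m) = (m - 1) * (m + 1)\<^sup>2 * m"
    using p_gt_2 p_m by (simp add: m_def of_nat_diff power2_eq_square)
  also have "(\<Sum>b<p. \<Sum>c<p. \<bar>m + m\<^sup>2 * h b * h c\<bar>) =
      \<bar>m + m\<^sup>2 * m * m\<bar> + m * \<bar>m + m\<^sup>2 * m * -1\<bar> + m * (\<bar>m + m\<^sup>2 * -1 * m\<bar> + m * \<bar>m + m\<^sup>2 * -1 * -1\<bar>)"
  proof -
    have "(\<Sum>c<p. \<bar>m + m\<^sup>2 * s * h c\<bar>) = \<bar>m + m\<^sup>2 * s * m\<bar> + m * \<bar>m + m\<^sup>2 * s * -1\<bar>" for s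
      by (rule split)
    then show ?thesis
      by (simp only: split[of "\<lambda>s. \<bar>m + m\<^sup>2 * s * m\<bar> + m * \<bar>m + m\<^sup>2 * s * -1\<bar>"])
  qed
  also have "\<bar>m + m\<^sup>2 * m * m\<bar> = m + m ^ 4" using m_pos by (simp add: power2_eq_square power4_eq_xxxx)
  also have "\<bar>m + m\<^sup>2 * -1 * -1\<bar> = m + m\<^sup>2" using m_pos by simp
  \<comment> \<open>Here \<open>m - m ^ 3\<close> is at most \<open>0\<close> because
    \<open>m \<ge> 1\<close>, so the sign flips. Without the absolute value the total would be
    smaller.\<close>
  also have abs: "\<bar>m + m\<^sup>2 * m * -1\<bar> = m ^ 3 - m"
  proof -
    have "m * 1 \<le> m * m\<^sup>2" using m1 by (intro mult_left_mono) (auto simp: power2_eq_square mult_ge1_I)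
    then show ?thesis by (simp add: power2_eq_square power3_eq_cube)
  qed
  also have "\<bar>m + m\<^sup>2 * -1 * m\<bar> = m ^ 3 - m" using abs by simp
  finally have total: "(\<Sum>x\<in>carrier G. \<Sum>y\<in>carrier G. K x y) = m\<^sup>2 * (m + 1) * (5 * m - 3)"
    by (simp add: algebra_simps power2_eq_square power3_eq_cube power4_eq_xxxx)
  have "AM_Z G = (m\<^sup>2 * (m + 1) * (5 * m - 3)) / ((m + 1) * m)\<^sup>2"
    using AM_Z_sum_elements[OF group_G finite_G] total
    by (simp add: K_def order_G p_m m_def[symmetric])
  also have "\<dots> = 5 - 8 / (m + 1)"
  proof -
    have "((m + 1) * m)\<^sup>2 = (m\<^sup>2 * (m + 1)) * (m + 1)" by (simp add: power2_eq_square)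
    moreover have "m\<^sup>2 * (m + 1) \<noteq> 0" using m_pos by simp
    ultimately have "(m\<^sup>2 * (m + 1) * (5 * m - 3)) / ((m + 1) * m)\<^sup>2 = (5 * m - 3) / (m + 1)"
      by simp
    then show ?thesis using m_pos by (simp add: field_simps)
  qed
  finally show ?thesis by (simp add: p_m)
qed

end

section \<open>Letting the prime tend to infinity\<close>

theorem mainTheorem5:
  shows "\<exists>G :: nat \<Rightarrow> nat monoid.
    (\<forall>i. group (G i) \<and> finite (carrier (G i))) \<and>
    (SUP i. ereal (real (Max (char_degree (G i) ` Irr (G i))))) = \<infinity> \<and>
    (SUP i. ereal (AM_Z (G i))) = 5"
proof -
  \<comment> \<open>The margin \<open>2\<close> makes every prime odd and gives
    \<open>P i - 1 \<ge> i\<close>, so the degrees are unbounded.\<close>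
  have "\<exists>q. prime q \<and> i + 2 < q" for i :: nat
    using bigger_prime by blast
  then obtain P where P: "\<And>i. prime (P i)" "\<And>i :: nat. i + 2 < P i" by metis
  have "\<exists>g. residue_primroot (P i) g" for i
    using prime_primitive_root_exists[of "P i"] P[of i] by (auto simp: prime_gt_1_nat)
  then obtain g where g: "\<And>i. residue_primroot (P i) (g i)" by metis
  have loc: "affine_group (P i) (g i)" for i
    using P[of i] g[of i] by unfold_locales auto
  define G where "G i = affine_group.G (P i) (g i)" for i
  note facts = affine_group.group_G[OF loc, folded G_def] affine_group.finite_G[OF loc, folded G_def]
  have deg: "i \<le> Max (char_degree (G i) ` Irr (G i))" for i
    using affine_group.max_degree[OF loc, folded G_def, of i] P(2)[of i] by simp
  have AM: "AM_Z (G i) = 5 - 8 / real (P i)" for i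
    using affine_group.AM_Z_G[OF loc, folded G_def] .
  have "(SUP i. ereal (real (Max (char_degree (G i) ` Irr (G i))))) = \<infinity>"
  proof (rule SUP_PInfty)
    fix n :: nat
    show "\<exists>i\<in>UNIV. ereal (real n) \<le> ereal (real (Max (char_degree (G i) ` Irr (G i))))"
      using deg[of n] by (intro bexI[of _ n]) auto
  qed
  moreover have "(SUP i. ereal (AM_Z (G i))) = 5"
  proof (rule SUP_eqI)
    show "ereal (AM_Z (G i)) \<le> 5" for i by (simp add: AM)
    fix y assume y: "\<And>i. i \<in> UNIV \<Longrightarrow> ereal (AM_Z (G i)) \<le> y"
    \<comment> \<open>The value \<open>5\<close> is never attained, so an upper bound
      \<open>y\<close> is compared with the limit.\<close>
    have "(\<lambda>i. 5 - 8 / real (P i)) \<longlonglongrightarrow> 5 - 0"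
    proof (intro tendsto_diff tendsto_const)
      have "i \<le> P i" for i using P(2)[of i] by simp
      then have "filterlim P at_top at_top"
        by (intro filterlim_at_top_mono[OF filterlim_ident always_eventually]) simp
      then show "(\<lambda>i. 8 / real (P i)) \<longlonglongrightarrow> 0"
        by (intro tendsto_divide_0[OF tendsto_const] filterlim_at_top_imp_at_infinity
            filterlim_compose[OF filterlim_real_sequentially])
    qed
    then have "(\<lambda>i. ereal (AM_Z (G i))) \<longlonglongrightarrow> 5" by (simp add: AM)
    then show "5 \<le> y" by (rule LIMSEQ_le_const2[where X = "\<lambda>i. ereal (AM_Z (G i))"]) (use y in auto)
  qed
  ultimately show ?thesis using facts by blast
qed

end
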